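(* Let $d\ge2$, $N=d-1$ and $0<\alpha<1$. Almost surely, $$\dim_{\mathrm H}\overline{X(S^{d-1})}\leq N\alpha .$$ In particular, almost surely $\dim_{\mathrm H}F_\alpha\leq(d-1)\alpha$.
   Context: $S^{d-1}$ is the unit sphere of $\mathbb R^d$. Let $\tau_1,\tau_2,\dots$ be independent standard exponential random variables, $\Gamma_k=\tau_1+\cdots+\tau_k$, and let $\varepsilon_1,\varepsilon_2,\dots$ be independent random points of $S^{d-1}$, each with the uniform (rotation-invariant) probability law, independent of $(\tau_k)$. Put $\gamma_k=\Gamma_k^{-1/\alpha}$; since $0<\alpha<1$, $\sum_k\gamma_k<\infty$ almost surely. $Z_\alpha=\bigoplus_{k\ge1}\gamma_k[0,\varepsilon_k]$ is the almost sure limit in the Hausdorff metric of the partial Minkowski sums $\bigoplus_{k\le n}\gamma_k[0,\varepsilon_k]$, where $[0,x]=\{sx:0\le s\le1\}$, and $F_\alpha=\operatorname{ext}Z_\alpha$ is its set of extreme points. The random field $X$ is $$X(u)=\sum_{k=1}^{\infty}\gamma_k\varepsilon_k\mathbf 1_{\{\langle u,\varepsilon_k\rangle>0\}},\qquad u\in S^{d-1},$$ which almost surely converges absolutely and uniformly in $u$; $X(S^{d-1})$ is its image and the bar denotes closure in $\mathbb R^d$. $\dim_{\mathrm H}$ is Hausdorff dimension. *)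

theory Defs
  imports "HOL-Probability.Probability" "HOL-Library.Set_Algebras"
begin

text \<open>
  The \<open>s\<close>-th power of the diameter, with the usual conventions: the empty set contributes
  \<open>0\<close>, and every nonempty set contributes \<open>1\<close> for \<open>s = 0\<close> (note that \<open>0 powr 0 = 0\<close> here).
\<close>

definition diam_power :: "real \<Rightarrow> 'a::metric_space set \<Rightarrow> ennreal" where
  "diam_power s U =
     (if U = {} then 0 else if s = 0 then 1 else ennreal (diameter U powr s))"

text \<open>Boundedness is required because \<^const>\<open>diameter\<close> is meaningless on unbounded sets.\<close>

definition hausdorff_premeasure :: "real \<Rightarrow> real \<Rightarrow> 'a::metric_space set \<Rightarrow> ennreal" where
  "hausdorff_premeasure s \<delta> A =
     (INF U \<in> {U :: nat \<Rightarrow> 'a set.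
                 A \<subseteq> (\<Union>i. U i) \<and> (\<forall>i. bounded (U i) \<and> diameter (U i) \<le> \<delta>)}.
        \<Sum>i. diam_power s (U i))"

definition hausdorff_measure :: "real \<Rightarrow> 'a::metric_space set \<Rightarrow> ennreal" where
  "hausdorff_measure s A = (SUP \<delta>\<in>{0<..}. hausdorff_premeasure s \<delta> A)"

definition hausdorff_dim :: "'a::metric_space set \<Rightarrow> ennreal" where
  "hausdorff_dim A = (INF s\<in>{s. 0 \<le> s \<and> hausdorff_measure s A = 0}. ennreal s)"

text \<open>A metric on the nonempty compact sets; only meaningful for nonempty bounded arguments.\<close>

definition hausdorff_dist :: "'a::metric_space set \<Rightarrow> 'a set \<Rightarrow> real" where
  "hausdorff_dist A B = max (SUP a\<in>A. infdist a B) (SUP b\<in>B. infdist b A)"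

definition hausdorff_lim :: "(nat \<Rightarrow> 'a::metric_space set) \<Rightarrow> 'a set" where
  "hausdorff_lim K =
     (THE L. compact L \<and> L \<noteq> {} \<and> (\<lambda>n. hausdorff_dist (K n) L) \<longlonglongrightarrow> 0)"

text \<open>
  These conditions determine the law uniquely. It is a measure on the Borel sets of the ambient
  space that is concentrated on the sphere.
\<close>

definition uniform_sphere_law :: "'a::euclidean_space measure \<Rightarrow> bool" where
  "uniform_sphere_law \<mu> \<longleftrightarrow>
     prob_space \<mu> \<and> sets \<mu> = sets borel \<and> emeasure \<mu> (sphere 0 1) = 1 \<and>
     (\<forall>f. orthogonal_transformation f \<longrightarrow> distr \<mu> borel f = \<mu>)"

text \<open>
  All sequences are indexed from \<open>0\<close>: \<open>\<tau> k\<close>, \<open>\<epsilon> k\<close>, \<open>\<Gamma> \<tau> k\<close> and \<open>\<gamma> \<alpha> \<tau> k\<close> below are the objects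
  usually numbered \<open>k + 1\<close>.
\<close>

definition \<Gamma> :: "(nat \<Rightarrow> 'w \<Rightarrow> real) \<Rightarrow> nat \<Rightarrow> 'w \<Rightarrow> real" where
  "\<Gamma> \<tau> k \<omega> = (\<Sum>j\<le>k. \<tau> j \<omega>)"

definition \<gamma> :: "real \<Rightarrow> (nat \<Rightarrow> 'w \<Rightarrow> real) \<Rightarrow> nat \<Rightarrow> 'w \<Rightarrow> real" where
  "\<gamma> \<alpha> \<tau> k \<omega> = \<Gamma> \<tau> k \<omega> powr (- 1 / \<alpha>)"

definition X_field ::
    "real \<Rightarrow> (nat \<Rightarrow> 'w \<Rightarrow> real) \<Rightarrow> (nat \<Rightarrow> 'w \<Rightarrow> 'a::euclidean_space) \<Rightarrow> 'w \<Rightarrow> 'a \<Rightarrow> 'a" where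
  "X_field \<alpha> \<tau> \<epsilon> \<omega> u =
     (\<Sum>k. (\<gamma> \<alpha> \<tau> k \<omega> * indicator {v. u \<bullet> v > 0} (\<epsilon> k \<omega>)) *\<^sub>R \<epsilon> k \<omega>)"

text \<open>The sum of sets is the Minkowski sum.\<close>

definition Z_partial ::
    "real \<Rightarrow> (nat \<Rightarrow> 'w \<Rightarrow> real) \<Rightarrow> (nat \<Rightarrow> 'w \<Rightarrow> 'a::euclidean_space) \<Rightarrow> 'w \<Rightarrow> nat \<Rightarrow> 'a set" where
  "Z_partial \<alpha> \<tau> \<epsilon> \<omega> n = (\<Sum>k<n. (*\<^sub>R) (\<gamma> \<alpha> \<tau> k \<omega>) ` closed_segment 0 (\<epsilon> k \<omega>))"

definition Z_zonoid ::
    "real \<Rightarrow> (nat \<Rightarrow> 'w \<Rightarrow> real) \<Rightarrow> (nat \<Rightarrow> 'w \<Rightarrow> 'a::euclidean_space) \<Rightarrow> 'w \<Rightarrow> 'a set" where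
  "Z_zonoid \<alpha> \<tau> \<epsilon> \<omega> = hausdorff_lim (Z_partial \<alpha> \<tau> \<epsilon> \<omega>)"

definition F_ext ::
    "real \<Rightarrow> (nat \<Rightarrow> 'w \<Rightarrow> real) \<Rightarrow> (nat \<Rightarrow> 'w \<Rightarrow> 'a::euclidean_space) \<Rightarrow> 'w \<Rightarrow> 'a set" where
  "F_ext \<alpha> \<tau> \<epsilon> \<omega> = {x. x extreme_point_of Z_zonoid \<alpha> \<tau> \<epsilon> \<omega>}"

end

theory Submission
  imports Defs
begin

text \<open>
  Write \<open>d\<close> for the dimension and \<open>a = 1 / \<alpha> > 1\<close>. The jumps \<open>\<gamma> k\<close> are at most
  \<open>C (k + 1) powr (- a)\<close> with a random constant \<open>C\<close> (\<open>AE_eventually_Gamma_ge\<close>, \<open>gamma_power_decay\<close>).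

  At level \<open>n\<close> the directions are divided into about \<open>n\<^sup>d\<^sup>-\<^sup>1\<close> deterministic cells of angular size \<open>1 / n\<close>,
  indexed by the integer points on the boundary of a cube (\<open>lattice_shell_covers_directions\<close>). The
  field jumps inside a cell only across the hyperplanes orthogonal to those \<open>\<epsilon> k\<close> that are nearly
  orthogonal to its centre. This has probability of order \<open>1 / n\<close> for each \<open>k\<close>
  (\<open>uniform_sphere_law_slab_le\<close>). So among the first \<open>n\<close> hyperplanes a bounded number are expected
  to meet a given cell, and \<open>m\<close> of them cut it into at most \<open>2\<^sup>m\<close> classes on which the first \<open>n\<close>
  terms are constant (\<open>card_pos_pattern_cell_le\<close>). Inside such a class the field varies by at most
  the sum of the later jumps across hyperplanes meeting the cell, whose expectation has order
  \<open>1 / n \<cdot> (\<Sum>k\<ge>n. (k + 1) powr (- a))\<close>, that is \<open>n powr (- a)\<close> (\<open>dist_X_le_hit_weight\<close>).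

  Both the number of classes and the variation on them in units of \<open>n powr (- a)\<close> are controlled by one
  weighted count of hyperplanes, whose exponential moments are bounded uniformly in the cell and in \<open>n\<close>
  (\<open>nn_integral_exp_hit_weight_le\<close>). Hence the expected sum of the \<open>s\<close>-th powers of the diameters in
  the resulting covering is of order \<open>n powr (d - 1 - s a)\<close>. It tends to zero when \<open>s > (d - 1) \<alpha>\<close>,
  and Fatou's lemma gives a vanishing \<open>s\<close>-dimensional Hausdorff measure almost surely
  (\<open>AE_shell_cost_arbitrarily_small\<close>, \<open>hausdorff_measure_closure_X_eq_0\<close>).

  The bound for the extreme points follows without further probability. Since \<open>X u\<close> maximises the
  inner product with \<open>u\<close> over the zonoid, the zonoid is the convex hull of the compact set
  \<open>closure (X ` sphere 0 1)\<close>, and extreme points of a convex hull lie in the generating set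
  (\<open>hausdorff_lim_Z\<close>, \<open>extreme_points_hausdorff_lim_Z\<close>).
\<close>

section \<open>A cubical net of directions\<close>

text \<open>
  The integer points on the boundary of the cube \<open>[-n, n]\<^sup>d\<close>. Directions are discretised on this
  cube instead of on the sphere because its boundary has an explicit net with about \<open>n\<^sup>d\<^sup>-\<^sup>1\<close> points.
\<close>

definition lattice_shell :: "nat \<Rightarrow> 'a::euclidean_space set" where
  "lattice_shell n = {V. (\<forall>i\<in>Basis. V \<bullet> i \<in> \<int> \<and> \<bar>V \<bullet> i\<bar> \<le> real n) \<and> (\<exists>b\<in>Basis. \<bar>V \<bullet> b\<bar> = real n)}"

text \<open>
  A point of the shell is given by a coordinate \<open>b\<close> of modulus \<open>n\<close>, the sign \<open>\<sigma>\<close> of that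
  coordinate, and the other \<open>d - 1\<close> coordinates in \<open>{-n..n}\<close>.
\<close>

lemma lattice_shell_finite_card:
  fixes n :: nat
  shows "finite (lattice_shell n :: 'a::euclidean_space set)"
    and "card (lattice_shell n :: 'a set) \<le> 2 * DIM('a) * (2 * n + 1) ^ (DIM('a) - 1)"
proof -
  define G where "G b = PiE (Basis - {b}) (\<lambda>_. {- int n..int n})" for b :: 'a
  define vec where "vec b = (\<lambda>(\<sigma>, g). (\<sigma> * real n) *\<^sub>R b + (\<Sum>i\<in>Basis - {b}. of_int (g i) *\<^sub>R i))" for b :: 'a
  have sub: "lattice_shell n \<subseteq> (\<Union>b\<in>(Basis::'a set). vec b ` ({-1, 1} \<times> G b))"
  proof
    fix V :: 'a assume V: "V \<in> lattice_shell n"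
    then obtain b where b: "b \<in> Basis" "\<bar>V \<bullet> b\<bar> = real n" by (auto simp: lattice_shell_def)
    define g where "g = restrict (\<lambda>i. \<lfloor>V \<bullet> i\<rfloor>) (Basis - {b})"
    define \<sigma> :: real where "\<sigma> = (if V \<bullet> b < 0 then -1 else 1)"
    have fl: "of_int \<lfloor>V \<bullet> i\<rfloor> = V \<bullet> i" if "i \<in> Basis" for i
      using V that by (auto simp: lattice_shell_def elim!: Ints_cases)
    have "g \<in> G b" unfolding G_def g_def
    proof (rule restrict_PiE_iff[THEN iffD2], rule ballI)
      fix i assume i: "i \<in> Basis - {b}"
      have "\<bar>of_int \<lfloor>V \<bullet> i\<rfloor>\<bar> \<le> real n" using V i fl[of i] by (auto simp: lattice_shell_def)
      then show "\<lfloor>V \<bullet> i\<rfloor> \<in> {- int n..int n}" by (auto simp: abs_le_iff)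
    qed
    moreover have "V = vec b (\<sigma>, g)"
    proof -
      have "V = (\<Sum>i\<in>Basis. (V \<bullet> i) *\<^sub>R i)" by (simp add: euclidean_representation)
      also have "\<dots> = (V \<bullet> b) *\<^sub>R b + (\<Sum>i\<in>Basis - {b}. (V \<bullet> i) *\<^sub>R i)"
        using b by (simp add: sum.remove)
      also have "V \<bullet> b = \<sigma> * real n" using b by (auto simp: \<sigma>_def)
      also have "(\<Sum>i\<in>Basis - {b}. (V \<bullet> i) *\<^sub>R i) = (\<Sum>i\<in>Basis - {b}. of_int (g i) *\<^sub>R i)"
        by (intro sum.cong) (auto simp: g_def fl)
      finally show ?thesis by (simp add: vec_def)
    qed
    moreover have "\<sigma> \<in> {-1, 1}" by (simp add: \<sigma>_def)
    ultimately show "V \<in> (\<Union>b\<in>(Basis::'a set). vec b ` ({-1, 1} \<times> G b))" using b by blast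
  qed
  have finG: "finite (G b)" for b by (auto simp: G_def intro!: finite_PiE)
  then have fin: "finite (\<Union>b\<in>(Basis::'a set). vec b ` ({-1, 1} \<times> G b))" by auto
  show "finite (lattice_shell n :: 'a set)" using sub fin by (rule finite_subset)
  have "card (lattice_shell n :: 'a set) \<le> card (\<Union>b\<in>(Basis::'a set). vec b ` ({-1, 1} \<times> G b))"
    using sub fin by (intro card_mono)
  also have "\<dots> \<le> (\<Sum>b\<in>(Basis::'a set). card (vec b ` ({-1, 1} \<times> G b)))"
    by (intro card_UN_le) auto
  also have "\<dots> \<le> (\<Sum>b\<in>(Basis::'a set). 2 * (2 * n + 1) ^ (DIM('a) - 1))"
  proof (intro sum_mono)
    fix b :: 'a assume b: "b \<in> Basis"
    have "card (vec b ` ({-1, 1} \<times> G b)) \<le> card ({-1, 1::real} \<times> G b)"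
      using finG by (intro card_image_le) auto
    also have "\<dots> = 2 * card (G b)" by (simp add: card_cartesian_product)
    also have "card (G b) = (2 * n + 1) ^ (DIM('a) - 1)"
      using b by (simp add: G_def card_PiE nat_add_distrib nat_mult_distrib)
    finally show "card (vec b ` ({-1, 1} \<times> G b)) \<le> 2 * (2 * n + 1) ^ (DIM('a) - 1)" .
  qed
  finally show "card (lattice_shell n :: 'a set) \<le> 2 * DIM('a) * (2 * n + 1) ^ (DIM('a) - 1)"
    by (simp add: algebra_simps)
qed

lemma norm_lattice_shell_ge:
  assumes "V \<in> lattice_shell n" shows "norm V \<ge> real n"
  using assms Basis_le_norm[of _ V] unfolding lattice_shell_def by fastforce

text \<open>
  Scale \<open>u\<close> to the boundary of the cube and round every coordinate towards zero: this moves no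
  coordinate out of \<open>[-n, n]\<close> and fixes the one of modulus \<open>n\<close>.
\<close>

lemma lattice_shell_covers_directions:
  fixes u :: "'a::euclidean_space"
  assumes "u \<noteq> 0" "n > 0"
  obtains c V where "c > 0" "V \<in> lattice_shell n" "\<forall>i\<in>Basis. \<bar>(c *\<^sub>R u - V) \<bullet> i\<bar> \<le> 1"
proof -
  define m where "m = Max ((\<lambda>i. \<bar>u \<bullet> i\<bar>) ` Basis)"
  have "m \<in> (\<lambda>i. \<bar>u \<bullet> i\<bar>) ` Basis" unfolding m_def by (intro Max_in) auto
  then obtain b where b: "b \<in> Basis" "m = \<bar>u \<bullet> b\<bar>" by auto
  have le: "\<bar>u \<bullet> i\<bar> \<le> m" if "i \<in> Basis" for i
    unfolding m_def using that by (intro Max_ge) auto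
  have "m > 0"
  proof (rule ccontr)
    assume "\<not> m > 0"
    then have "u \<bullet> i = 0" if "i \<in> Basis" for i using le[OF that] by linarith
    then have "u = 0" by (simp add: euclidean_eq_iff[of u])
    with assms show False by simp
  qed
  define c where "c = real n / m"
  have c: "c > 0" using assms \<open>m > 0\<close> by (simp add: c_def)
  define r where "r t = (if t < 0 then of_int \<lceil>t\<rceil> else of_int \<lfloor>t\<rfloor> :: real)" for t :: real
  have r: "r t \<in> \<int>" "\<bar>t - r t\<bar> \<le> 1" "\<bar>r t\<bar> \<le> \<bar>t\<bar>" for t
    by (auto simp: r_def) linarith+
  have rint: "r t = t" if "t \<in> \<int>" for t using that by (auto simp: r_def elim!: Ints_cases)
  define V where "V = (\<Sum>i\<in>Basis. r ((c *\<^sub>R u) \<bullet> i) *\<^sub>R i)"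
  have Vi: "V \<bullet> i = r ((c *\<^sub>R u) \<bullet> i)" if "i \<in> Basis" for i
    using that by (simp add: V_def)
  have cu: "\<bar>(c *\<^sub>R u) \<bullet> i\<bar> \<le> real n" if "i \<in> Basis" for i
    using le[OF that] \<open>m > 0\<close> by (simp add: c_def abs_mult field_simps)
       (metis mult.commute mult_left_mono of_nat_0_le_iff)
  have cb: "\<bar>(c *\<^sub>R u) \<bullet> b\<bar> = real n"
    using b \<open>m > 0\<close> by (simp add: c_def abs_mult)
  then have "(c *\<^sub>R u) \<bullet> b = real n \<or> (c *\<^sub>R u) \<bullet> b = - real n" by linarith
  then have "(c *\<^sub>R u) \<bullet> b \<in> \<int>" by auto
  then have "\<bar>V \<bullet> b\<bar> = real n" using cb Vi[OF b(1)] rint by simp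
  moreover have "V \<bullet> i \<in> \<int> \<and> \<bar>V \<bullet> i\<bar> \<le> real n" if "i \<in> Basis" for i
    using Vi[OF that] r cu[OF that] by (metis order_trans)
  ultimately have "V \<in> lattice_shell n" using b by (auto simp: lattice_shell_def)
  moreover have "\<forall>i\<in>Basis. \<bar>(c *\<^sub>R u - V) \<bullet> i\<bar> \<le> 1"
    using Vi r by (simp add: inner_diff_left)
  ultimately show thesis using that c by blast
qed

section \<open>Slabs under the uniform law on the sphere\<close>

lemma exists_orthogonal_transformation_mapping:
  fixes a b :: "'a::euclidean_space"
  assumes "norm a = norm b"
  obtains f where "orthogonal_transformation f" "f a = b"
proof (cases "a = b")
  case True
  then show thesis using that[of id] by (simp add: orthogonal_transformation_def linear_id)
next
  case False
  \<comment> \<open>\<open>f\<close> is the reflection in the hyperplane orthogonal to \<open>a - b\<close>.\<close>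
  define w where "w = a - b"
  define f where "f x = x - (2 * (x \<bullet> w) / (w \<bullet> w)) *\<^sub>R w" for x
  have w: "w \<bullet> w \<noteq> 0" using False by (simp add: w_def)
  have lin: "linear f"
    by (rule linearI) (simp_all add: f_def inner_add_left algebra_simps add_divide_distrib)
  have "f x \<bullet> f y = x \<bullet> y" for x y
  proof -
    define p where "p = x \<bullet> w"
    define q where "q = y \<bullet> w"
    define t where "t = 2 / (w \<bullet> w)"
    have "t * (w \<bullet> w) = 2" using w by (simp add: t_def)
    have fxy: "f x = x - (t * p) *\<^sub>R w" "f y = y - (t * q) *\<^sub>R w"
      by (simp_all add: f_def p_def q_def t_def)
    have "f x \<bullet> f y = x \<bullet> y - t * q * p - t * p * q + t * p * q * (t * (w \<bullet> w))"
      unfolding fxy by (simp add: inner_diff_left inner_diff_right inner_commute[of w x] inner_commute[of w y]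
          p_def q_def algebra_simps)
    then show ?thesis unfolding \<open>t * (w \<bullet> w) = 2\<close> by simp
  qed
  with lin have "orthogonal_transformation f" by (simp add: orthogonal_transformation_def)
  moreover have "a \<bullet> a = b \<bullet> b" using assms by (simp add: norm_eq_sqrt_inner)
  then have "2 * (a \<bullet> w) = w \<bullet> w" by (simp add: w_def inner_diff inner_commute)
  then have "f a = b" using w by (simp add: f_def w_def)
  ultimately show thesis using that by blast
qed

lemma card_nat_le_spread:
  fixes S :: "nat set" and L :: real
  assumes "finite S" "L \<ge> 0" "\<And>i j. i \<in> S \<Longrightarrow> j \<in> S \<Longrightarrow> real i - real j \<le> L"
  shows "real (card S) \<le> L + 1"
proof (cases "S = {}")
  case False
  have "S \<subseteq> {Min S..Max S}" using assms(1) by auto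
  then have "card S \<le> Suc (Max S) - Min S" using card_mono[of "{Min S..Max S}" S] by simp
  moreover have "Min S \<le> Max S" using False assms(1) by (simp add: Min_le_iff)
  ultimately have "real (card S) \<le> real (Max S) - real (Min S) + 1" by linarith
  with assms(3)[of "Max S" "Min S"] False assms(1) show ?thesis by simp
qed (use assms in auto)

text \<open>
  A unit vector \<open>x\<close> has a coordinate \<open>b\<close> of modulus at least \<open>1 / d\<close>. When all other coordinates of
  the grid point \<open>g\<close> are fixed, the condition confines \<open>g b\<close> to an interval of length at most
  \<open>2 R d\<close>.
\<close>

lemma card_grid_in_slab_le:
  fixes x :: "'a::euclidean_space" and R :: real
  assumes x: "norm x = 1" and R: "R \<ge> 0"
  shows "real (card {g \<in> PiE Basis (\<lambda>_. {1..m}). \<bar>(\<Sum>i\<in>Basis. real (g i) * (i \<bullet> x))\<bar> \<le> R})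
          \<le> real m ^ (DIM('a) - 1) * (2 * R * real DIM('a) + 1)"
proof -
  define A where "A = {g \<in> PiE (Basis::'a set) (\<lambda>_. {1..m}). \<bar>(\<Sum>i\<in>Basis. real (g i) * (i \<bullet> x))\<bar> \<le> R}"
  obtain b where b: "b \<in> Basis" "\<bar>b \<bullet> x\<bar> \<ge> 1 / real DIM('a)"
  proof -
    have "\<exists>b\<in>(Basis::'a set). 1 / real DIM('a) \<le> \<bar>b \<bullet> x\<bar>"
    proof (rule ccontr)
      assume "\<not> ?thesis"
      then have "(\<Sum>i\<in>(Basis::'a set). \<bar>x \<bullet> i\<bar>) < (\<Sum>i\<in>(Basis::'a set). 1 / real DIM('a))"
        by (intro sum_strict_mono) (auto simp: inner_commute not_le)
      with norm_le_l1[of x] x show False by simp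
    qed
    then show thesis using that by blast
  qed
  define H where "H = PiE (Basis - {b}) (\<lambda>_. {1..m})"
  define F where "F h = {g \<in> A. restrict g (Basis - {b}) = h}" for h
  have finA: "finite A" unfolding A_def by (intro finite_Collect_conjI) (auto intro: finite_PiE)
  have finH: "finite H" unfolding H_def by (intro finite_PiE) auto
  have "A \<subseteq> (\<Union>h\<in>H. F h)" by (auto simp: A_def H_def F_def PiE_iff)
  then have "card A \<le> card (\<Union>h\<in>H. F h)"
    using finA finH by (intro card_mono) (auto simp: F_def)
  also have "\<dots> \<le> (\<Sum>h\<in>H. card (F h))" using finH by (rule card_UN_le)
  finally have "real (card A) \<le> (\<Sum>h\<in>H. real (card (F h)))" by (simp flip: of_nat_sum)
  also have "\<dots> \<le> (\<Sum>h\<in>H. 2 * R * real DIM('a) + 1)"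
  proof (rule sum_mono)
    fix h assume "h \<in> H"
    have split: "(\<Sum>i\<in>Basis. real (g i) * (i \<bullet> x)) = real (g b) * (b \<bullet> x) + (\<Sum>i\<in>Basis - {b}. real (h i) * (i \<bullet> x))"
      if "g \<in> F h" for g
    proof -
      have "g i = h i" if "i \<in> Basis - {b}" for i
        using \<open>g \<in> F h\<close> that unfolding F_def by (metis (mono_tags, lifting) mem_Collect_eq restrict_apply')
      then show ?thesis using b by (simp add: sum.remove)
    qed
    have inj: "inj_on (\<lambda>g. g b) (F h)"
    proof (rule inj_onI)
      fix g g' assume g: "g \<in> F h" "g' \<in> F h" "g b = g' b"
      then have "restrict g (Basis - {b}) = restrict g' (Basis - {b})" by (simp add: F_def)
      then have "g i = g' i" if "i \<in> Basis" for i using g(3) that by (metis Diff_iff restrict_apply' singletonD)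
      moreover have "g \<in> PiE Basis (\<lambda>_. {1..m})" "g' \<in> PiE Basis (\<lambda>_. {1..m})"
        using g(1,2) unfolding F_def A_def by blast+
      ultimately show "g = g'" by (intro PiE_ext)
    qed
    have "real (card ((\<lambda>g. g b) ` F h)) \<le> 2 * R * real DIM('a) + 1"
    proof (rule card_nat_le_spread)
      show "finite ((\<lambda>g. g b) ` F h)" using finA by (simp add: F_def)
      show "0 \<le> 2 * R * real DIM('a)" using R by simp
      fix i j assume "i \<in> (\<lambda>g. g b) ` F h" "j \<in> (\<lambda>g. g b) ` F h"
      then obtain g g' where g: "g \<in> F h" "i = g b" "g' \<in> F h" "j = g' b" by auto
      define c where "c = (\<Sum>i\<in>Basis - {b}. real (h i) * (i \<bullet> x))"
      have "\<bar>real i * (b \<bullet> x) + c\<bar> \<le> R" "\<bar>real j * (b \<bullet> x) + c\<bar> \<le> R"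
        using split[OF g(1)] split[OF g(3)] g by (auto simp: F_def A_def c_def)
      then have "\<bar>(real i - real j) * (b \<bullet> x)\<bar> \<le> 2 * R" by (simp add: left_diff_distrib abs_le_iff)
      then have "\<bar>real i - real j\<bar> * \<bar>b \<bullet> x\<bar> \<le> 2 * R" by (simp add: abs_mult)
      moreover have "\<bar>real i - real j\<bar> * (1 / real DIM('a)) \<le> \<bar>real i - real j\<bar> * \<bar>b \<bullet> x\<bar>"
        using b by (intro mult_left_mono) auto
      ultimately have "\<bar>real i - real j\<bar> / real DIM('a) \<le> 2 * R" by simp
      then have "\<bar>real i - real j\<bar> \<le> 2 * R * real DIM('a)"
        by (simp add: pos_divide_le_eq)
      then show "real i - real j \<le> 2 * R * real DIM('a)" by linarith
    qed
    then show "real (card (F h)) \<le> 2 * R * real DIM('a) + 1" by (simp add: card_image[OF inj])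
  qed
  also have "\<dots> = real m ^ (DIM('a) - 1) * (2 * R * real DIM('a) + 1)"
    using b by (simp add: H_def card_PiE)
  finally show ?thesis by (simp add: A_def)
qed

lemma uniform_sphere_law_slab_eq:
  fixes \<mu> :: "'a::euclidean_space measure"
  assumes "uniform_sphere_law \<mu>" "norm v = norm v'"
  shows "measure \<mu> {x. \<bar>v \<bullet> x\<bar> \<le> r} = measure \<mu> {x. \<bar>v' \<bullet> x\<bar> \<le> r}"
proof -
  obtain f where f: "orthogonal_transformation f" "f v = v'"
    using exists_orthogonal_transformation_mapping[OF assms(2)] by blast
  have \<mu>: "distr \<mu> borel f = \<mu>" "sets \<mu> = sets borel"
    using assms f unfolding uniform_sphere_law_def by blast+
  have "linear f" using f by (simp add: orthogonal_transformation_linear)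
  then have [measurable]: "f \<in> borel_measurable borel"
    by (intro borel_measurable_continuous_onI linear_continuous_on linear_conv_bounded_linear[THEN iffD1])
  have "f \<in> measurable \<mu> borel" using \<mu>(2) by (simp cong: measurable_cong_sets)
  then have "measure (distr \<mu> borel f) {x. \<bar>v' \<bullet> x\<bar> \<le> r} = measure \<mu> (f -` {x. \<bar>v' \<bullet> x\<bar> \<le> r} \<inter> space \<mu>)"
    by (intro measure_distr) (auto simp: \<mu>)
  also have "f -` {x. \<bar>v' \<bullet> x\<bar> \<le> r} \<inter> space \<mu> = {x. \<bar>v \<bullet> x\<bar> \<le> r}"
    using f sets_eq_imp_space_eq[OF \<mu>(2)] by (auto simp: orthogonal_transformation_def)
  finally show ?thesis by (simp add: \<mu>)
qed

text \<open>
  By rotation invariance the probability of the slab does not depend on the unit vector \<open>v\<close>, so it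
  may be averaged over the directions of all grid points in \<open>{1..m}\<^sup>d\<close>. For each unit vector \<open>x\<close>
  \<open>card_grid_in_slab_le\<close> bounds the fraction of grid points whose slab contains \<open>x\<close>; the bound tends to
  \<open>2 d\<^sup>2 r\<close> as \<open>m\<close> grows. This elementary averaging replaces the density of the first coordinate of a
  uniform point of the sphere.
\<close>

lemma uniform_sphere_law_slab_le:
  fixes \<mu> :: "'a::euclidean_space measure"
  assumes \<mu>: "uniform_sphere_law \<mu>" and v: "norm v = 1" and r: "r \<ge> 0"
  shows "measure \<mu> {x. \<bar>v \<bullet> x\<bar> \<le> r} \<le> 2 * real DIM('a) ^ 2 * r"
proof -
  interpret prob_space \<mu> using \<mu> unfolding uniform_sphere_law_def by blast
  have sets: "sets \<mu> = sets borel" using \<mu> unfolding uniform_sphere_law_def by blast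
  have sp: "space \<mu> = UNIV" using sets_eq_imp_space_eq[OF sets] by simp
  have "emeasure \<mu> (sphere 0 1) = 1" using \<mu> unfolding uniform_sphere_law_def by blast
  then have "prob (sphere 0 1) = 1" by (simp add: measure_def)
  from AE_prob_1[OF this] have AE1: "AE x in \<mu>. norm x = 1" by simp
  define p where "p = measure \<mu> {x. \<bar>v \<bullet> x\<bar> \<le> r}"
  have bound: "p \<le> 2 * real DIM('a) ^ 2 * r + 1 / real m" if m: "m > 0" for m :: nat
  proof -
    define G where "G = PiE (Basis::'a set) (\<lambda>_. {1..m})"
    define vec :: "('a \<Rightarrow> nat) \<Rightarrow> 'a" where "vec g = (\<Sum>i\<in>Basis. real (g i) *\<^sub>R i)" for g
    \<comment> \<open>A grid point has norm at most \<open>d m\<close>, so the slab of width \<open>r\<close> around its normalisation lies in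
      the slab of width \<open>R\<close> around the grid point itself.\<close>
    define R where "R = r * (real DIM('a) * real m)"
    have finG: "finite G" unfolding G_def by (intro finite_PiE) auto
    have vecx: "vec g \<bullet> x = (\<Sum>i\<in>Basis. real (g i) * (i \<bullet> x))" for g x
      by (simp add: vec_def inner_sum_left)
    have meas: "{x. \<bar>w \<bullet> x\<bar> \<le> c} \<in> sets \<mu>" for w c unfolding sets by measurable
    have p_le: "p \<le> measure \<mu> {x. \<bar>vec g \<bullet> x\<bar> \<le> R}" if g: "g \<in> G" for g
    proof -
      have nz: "vec g \<noteq> 0"
      proof
        assume "vec g = 0"
        moreover obtain b :: 'a where b: "b \<in> Basis" using nonempty_Basis by blast
        moreover have "vec g \<bullet> b = real (g b)" using b by (simp add: vec_def)
        ultimately show False using g by (auto simp: G_def PiE_iff)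
      qed
      have "norm (vec g) \<le> (\<Sum>i\<in>(Basis::'a set). norm (real (g i) *\<^sub>R i))"
        unfolding vec_def by (rule norm_sum)
      also have "\<dots> \<le> (\<Sum>i\<in>(Basis::'a set). real m)"
        using g by (intro sum_mono) (auto simp: G_def PiE_iff)
      finally have le: "norm (vec g) \<le> real DIM('a) * real m" by simp
      have "p = measure \<mu> {x. \<bar>((1 / norm (vec g)) *\<^sub>R vec g) \<bullet> x\<bar> \<le> r}"
        unfolding p_def using \<mu> by (rule uniform_sphere_law_slab_eq) (simp add: v nz)
      also have "\<dots> \<le> measure \<mu> {x. \<bar>vec g \<bullet> x\<bar> \<le> R}"
      proof (rule finite_measure_mono[OF _ meas], safe)
        fix x assume "\<bar>((1 / norm (vec g)) *\<^sub>R vec g) \<bullet> x\<bar> \<le> r"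
        then have "\<bar>vec g \<bullet> x\<bar> \<le> r * norm (vec g)" using nz by (simp add: abs_mult field_simps)
        also have "\<dots> \<le> R" unfolding R_def using le r by (rule mult_left_mono)
        finally show "\<bar>vec g \<bullet> x\<bar> \<le> R" .
      qed
      finally show ?thesis .
    qed
    have "real m ^ DIM('a) * p = (\<Sum>g\<in>G. p)" by (simp add: G_def card_PiE)
    also have "\<dots> \<le> (\<Sum>g\<in>G. measure \<mu> {x. \<bar>vec g \<bullet> x\<bar> \<le> R})" by (intro sum_mono p_le)
    also have "\<dots> = (\<Sum>g\<in>G. \<integral>x. indicator {x. \<bar>vec g \<bullet> x\<bar> \<le> R} x \<partial>\<mu>)"
      by (simp add: sp)
    also have "\<dots> = (\<integral>x. (\<Sum>g\<in>G. indicator {x. \<bar>vec g \<bullet> x\<bar> \<le> R} x) \<partial>\<mu>)"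
      using meas by (intro Bochner_Integration.integral_sum[symmetric]) (auto simp: emeasure_eq_measure)
    also have "\<dots> \<le> real m ^ (DIM('a) - 1) * (2 * R * real DIM('a) + 1)"
    proof (rule integral_le_const)
      show "integrable \<mu> (\<lambda>x. \<Sum>g\<in>G. indicator {x. \<bar>vec g \<bullet> x\<bar> \<le> R} x :: real)"
        using meas by (intro Bochner_Integration.integrable_sum) (auto simp: emeasure_eq_measure)
      show "AE x in \<mu>. (\<Sum>g\<in>G. indicator {x. \<bar>vec g \<bullet> x\<bar> \<le> R} x)
              \<le> real m ^ (DIM('a) - 1) * (2 * R * real DIM('a) + 1)"
        using AE1
      proof eventually_elim
        case (elim x)
        have "(\<Sum>g\<in>G. indicator {x. \<bar>vec g \<bullet> x\<bar> \<le> R} x) = real (card {g \<in> G. \<bar>vec g \<bullet> x\<bar> \<le> R})"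
          using finG by (simp add: indicator_def sum.If_cases Int_def)
        also have "\<dots> \<le> real m ^ (DIM('a) - 1) * (2 * R * real DIM('a) + 1)"
          unfolding vecx G_def using r by (intro card_grid_in_slab_le elim) (simp add: R_def)
        finally show ?case .
      qed
    qed
    also have "real m ^ (DIM('a) - 1) * (2 * R * real DIM('a) + 1)
        = real m ^ DIM('a) * (2 * real DIM('a) ^ 2 * r + 1 / real m)"
    proof -
      have "real m ^ DIM('a) = real m ^ (DIM('a) - 1) * real m"
        by (metis DIM_positive power_minus_mult)
      then show ?thesis using m by (simp add: R_def field_simps power2_eq_square)
    qed
    finally show ?thesis using m by simp
  qed
  have "(\<lambda>m. 2 * real DIM('a) ^ 2 * r + 1 / real m) \<longlonglongrightarrow> 2 * real DIM('a) ^ 2 * r + 0"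
    by (intro tendsto_intros lim_1_over_n)
  moreover have "\<forall>\<^sub>F m in sequentially. p \<le> 2 * real DIM('a) ^ 2 * r + 1 / real m"
    using eventually_gt_at_top[of 0] by eventually_elim (rule bound)
  ultimately show ?thesis unfolding p_def[symmetric]
    by (metis add_0_right tendsto_lowerbound trivial_limit_sequentially)
qed

section \<open>Hyperplanes near a direction: exponential moments\<close>

text \<open>
  The decay \<open>(k + 1) powr (- a)\<close> of the jumps, multiplied by \<open>n powr a\<close> for \<open>k \<ge> n\<close> and replaced by
  \<open>1\<close> for \<open>k < n\<close>. With this normalisation one number, \<open>hit_weight\<close>, controls both the first \<open>n\<close> jumps,
  which have to be counted, and the later ones, which have to be summed.
\<close>

definition decay_weight :: "real \<Rightarrow> nat \<Rightarrow> nat \<Rightarrow> real" where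
  "decay_weight a n k = (if k < n then 1 else (real n / (real k + 1)) powr a)"

text \<open>
  The total weight of those \<open>e k\<close> whose orthogonal hyperplane may cut the cell of directions around
  \<open>V\<close>. The threshold is \<open>d\<close> because a point of the cell, suitably scaled, differs from \<open>V\<close> by at most
  \<open>1\<close> in every coordinate.
\<close>

definition hit_weight :: "real \<Rightarrow> nat \<Rightarrow> (nat \<Rightarrow> 'a::euclidean_space) \<Rightarrow> 'a \<Rightarrow> real" where
  "hit_weight a n e V =
     (\<Sum>k. decay_weight a n k * indicator {x. \<bar>V \<bullet> x\<bar> \<le> real DIM('a)} (e k))"

text \<open>
  Up to a constant factor, an upper bound for the sum of the \<open>s\<close>-th powers of the diameters in the
  covering of the image that the cells of level \<open>n\<close> provide. One factor \<open>exp (hit_weight a n e V)\<close>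
  counts the covering sets in a cell, a second one absorbs the \<open>s\<close>-th power of their diameter.
\<close>

definition shell_cost :: "real \<Rightarrow> real \<Rightarrow> nat \<Rightarrow> (nat \<Rightarrow> 'a::euclidean_space) \<Rightarrow> real" where
  "shell_cost s a n e = real n powr (- (s * a)) * (\<Sum>V\<in>lattice_shell n. exp (2 * hit_weight a n e V))"

lemma decay_weight_bounds:
  assumes "a > 0" shows "0 \<le> decay_weight a n k" "decay_weight a n k \<le> 1"
  using assms by (auto simp: decay_weight_def intro!: powr_le1)

lemma powr_succ_le_difference:
  fixes a x :: real
  assumes "a > 1" "x > 0"
  shows "(a - 1) * (x + 1) powr (- a) \<le> x powr (1 - a) - (x + 1) powr (1 - a)"
proof -
  have "\<exists>z>x. z < x + 1 \<and> (x + 1) powr (1 - a) - x powr (1 - a) = (x + 1 - x) * ((1 - a) * z powr (1 - a - 1))"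
  proof (rule MVT2)
    fix z assume "x \<le> z"
    then show "((\<lambda>z. z powr (1 - a)) has_real_derivative (1 - a) * z powr (1 - a - 1)) (at z)"
      using assms by (intro has_real_derivative_powr) simp
  qed simp
  then obtain z where z: "x < z" "z < x + 1"
    "(x + 1) powr (1 - a) - x powr (1 - a) = (1 - a) * z powr (- a)"
    by auto
  have "(x + 1) powr (- a) \<le> z powr (- a)"
    using z assms by (intro powr_mono2') auto
  then have "(a - 1) * (x + 1) powr (- a) \<le> (a - 1) * z powr (- a)"
    using assms by (intro mult_left_mono) auto
  with z(3) show ?thesis by (simp add: algebra_simps)
qed

text \<open>
  The first \<open>n\<close> weights contribute \<open>n\<close>, and so do the others up to a factor, because their sum is
  compared with the integral of \<open>x powr (- a)\<close> from \<open>n\<close> on.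
\<close>

lemma sum_decay_weight_le:
  assumes a: "a > 1" and n: "n \<ge> 1"
  shows "(\<Sum>k<m. decay_weight a n k) \<le> real n * (1 + 1 / (a - 1))"
proof (cases "m \<le> n")
  case True
  then have "(\<Sum>k<m. decay_weight a n k) = (\<Sum>k<m. 1)"
    by (intro sum.cong) (auto simp: decay_weight_def)
  also have "\<dots> \<le> real n * 1" using True by simp
  also have "\<dots> \<le> real n * (1 + 1 / (a - 1))" using a by (intro mult_left_mono) auto
  finally show ?thesis .
next
  case False
  define c where "c = real n powr a / (a - 1)"
  have c: "c \<ge> 0" using a by (simp add: c_def)
  have "(\<Sum>k<m. decay_weight a n k) \<le> real n + c * (real n powr (1 - a) - real m powr (1 - a))"
    if "n \<le> m" for m
    using that
  proof (induction m rule: dec_induct)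
    case base
    have "(\<Sum>k<n. decay_weight a n k) = (\<Sum>k<n. 1)"
      by (intro sum.cong) (auto simp: decay_weight_def)
    then show ?case by simp
  next
    case (step m)
    have "decay_weight a n m = real n powr a * (real m + 1) powr (- a)"
      using step.hyps by (simp add: decay_weight_def powr_divide powr_minus_divide)
    also have "\<dots> = c * ((a - 1) * (real m + 1) powr (- a))" using a by (simp add: c_def)
    also have "\<dots> \<le> c * (real m powr (1 - a) - (real m + 1) powr (1 - a))"
      using c a n step.hyps by (intro mult_left_mono powr_succ_le_difference) auto
    finally show ?case using step.IH by (simp add: algebra_simps)
  qed
  from this[of m] False have "(\<Sum>k<m. decay_weight a n k) \<le> real n + c * (real n powr (1 - a) - real m powr (1 - a))"
    by simp
  also have "\<dots> \<le> real n + c * real n powr (1 - a)"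
    using c by (intro add_left_mono mult_left_mono) auto
  also have "c * real n powr (1 - a) = real n / (a - 1)"
    using n by (simp add: c_def flip: powr_add)
  finally show ?thesis by (simp add: algebra_simps)
qed

lemma summable_decay_weight:
  assumes "a > 1" "n \<ge> 1" shows "summable (decay_weight a n)"
  using assms by (intro summableI_nonneg_bounded[OF _ sum_decay_weight_le] decay_weight_bounds) auto

lemma summable_hit_weight:
  assumes "a > 1" "n \<ge> 1"
  shows "summable (\<lambda>k. decay_weight a n k * indicator A (e k))"
  using decay_weight_bounds[of a n] assms
  by (intro summable_comparison_test'[OF summable_decay_weight[OF assms]]) (auto simp: indicator_def)

context prob_space begin

text \<open>
  Independence turns the exponential moment into a product. As \<open>exp w \<le> 1 + 4 w\<close> on \<open>[0, 2]\<close>, each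
  factor is at most \<open>1 + 4 p w k \<le> exp (4 p w k)\<close>. The range reaches \<open>2\<close> because the weights of
  interest are twice the decay weights.
\<close>

lemma nn_integral_exp_weighted_count_le:
  fixes \<epsilon> :: "nat \<Rightarrow> 'a \<Rightarrow> 'b::euclidean_space"
  assumes ind: "indep_vars (\<lambda>_. borel) \<epsilon> UNIV" and A: "A \<in> sets borel"
    and p: "\<And>k. prob (\<epsilon> k -` A \<inter> space M) \<le> p"
    and w: "\<And>k. 0 \<le> w k" "\<And>k. w k \<le> 2"
  shows "(\<integral>\<^sup>+\<omega>. ennreal (exp (\<Sum>k<m. w k * indicator A (\<epsilon> k \<omega>))) \<partial>M) \<le> ennreal (exp (4 * p * (\<Sum>k<m. w k)))"
proof -
  have [measurable]: "\<epsilon> k \<in> borel_measurable M" for k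
    using ind by (auto simp: indep_vars_def)
  note [measurable] = A
  have factor: "(\<integral>\<^sup>+\<omega>. ennreal (exp (w k * indicator A (\<epsilon> k \<omega>))) \<partial>M) \<le> ennreal (exp (4 * p * w k))" for k
  proof -
    have le: "exp (w k * indicator A (\<epsilon> k \<omega>)) \<le> 1 + 4 * w k * indicator A (\<epsilon> k \<omega>)" for \<omega>
    proof -
      have "exp (w k / 2) \<le> 1 + w k / 2 + (w k / 2)\<^sup>2" using w[of k] by (intro exp_bound) auto
      also have "\<dots> \<le> 1 + w k" using w[of k] mult_left_mono[of "w k" 2 "w k"] by (simp add: power2_eq_square)
      finally have "exp (w k / 2) ^ 2 \<le> (1 + w k) ^ 2" by (intro power_mono) auto
      moreover have "exp (w k / 2) ^ 2 = exp (w k)" by (simp flip: exp_double)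
      ultimately have "exp (w k) \<le> 1 + 4 * w k"
        using w[of k] mult_left_mono[of "w k" 2 "w k"] by (simp add: power2_eq_square algebra_simps)
      then show ?thesis by (simp add: indicator_def)
    qed
    have "(\<integral>\<^sup>+\<omega>. ennreal (exp (w k * indicator A (\<epsilon> k \<omega>))) \<partial>M)
        \<le> (\<integral>\<^sup>+\<omega>. 1 + ennreal (4 * w k) * indicator (\<epsilon> k -` A \<inter> space M) \<omega> \<partial>M)"
    proof (rule nn_integral_mono)
      fix \<omega> assume "\<omega> \<in> space M"
      have "ennreal (exp (w k * indicator A (\<epsilon> k \<omega>))) \<le> ennreal (1 + 4 * w k * indicator A (\<epsilon> k \<omega>))"
        by (rule ennreal_leI[OF le])
      also have "\<dots> = 1 + ennreal (4 * w k) * indicator (\<epsilon> k -` A \<inter> space M) \<omega>"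
        using w[of k] \<open>\<omega> \<in> space M\<close> by (auto simp: indicator_def ennreal_plus)
      finally show "ennreal (exp (w k * indicator A (\<epsilon> k \<omega>)))
          \<le> 1 + ennreal (4 * w k) * indicator (\<epsilon> k -` A \<inter> space M) \<omega>" .
    qed
    also have "\<dots> = 1 + ennreal (4 * w k) * emeasure M (\<epsilon> k -` A \<inter> space M)"
      by (subst nn_integral_add) (auto simp: nn_integral_cmult_indicator emeasure_space_1)
    also have "\<dots> = ennreal (1 + 4 * w k * prob (\<epsilon> k -` A \<inter> space M))"
      using w[of k] by (simp add: emeasure_eq_measure ennreal_mult ennreal_plus)
    also have "\<dots> \<le> ennreal (exp (4 * p * w k))"
    proof (rule ennreal_leI)
      have "1 + 4 * w k * prob (\<epsilon> k -` A \<inter> space M) \<le> 1 + 4 * w k * p"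
        using w p by (intro add_left_mono mult_left_mono) auto
      also have "\<dots> \<le> exp (4 * p * w k)"
        using exp_ge_add_one_self[of "4 * p * w k"] by (simp add: mult_ac)
      finally show "1 + 4 * w k * prob (\<epsilon> k -` A \<inter> space M) \<le> exp (4 * p * w k)" .
    qed
    finally show ?thesis .
  qed
  have ind': "indep_vars (\<lambda>_. borel) (\<lambda>k \<omega>. ennreal (exp (w k * indicator A (\<epsilon> k \<omega>)))) {..<m}"
    by (rule indep_vars_compose2[OF indep_vars_subset[OF ind]]) auto
  have "(\<integral>\<^sup>+\<omega>. ennreal (exp (\<Sum>k<m. w k * indicator A (\<epsilon> k \<omega>))) \<partial>M)
      = (\<integral>\<^sup>+\<omega>. (\<Prod>k<m. ennreal (exp (w k * indicator A (\<epsilon> k \<omega>)))) \<partial>M)"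
    by (simp add: exp_sum prod_ennreal del: sum_mult_indicator)
  also have "\<dots> = (\<Prod>k<m. \<integral>\<^sup>+\<omega>. ennreal (exp (w k * indicator A (\<epsilon> k \<omega>))) \<partial>M)"
    using ind' by (intro indep_vars_nn_integral) auto
  also have "\<dots> \<le> (\<Prod>k<m. ennreal (exp (4 * p * w k)))"
    by (induction m) (auto intro!: mult_mono factor)
  also have "\<dots> = ennreal (exp (4 * p * (\<Sum>k<m. w k)))"
    by (simp add: prod_ennreal exp_sum sum_distrib_left)
  finally show ?thesis .
qed

text \<open>
  A given hyperplane is near \<open>V\<close> with probability of order \<open>1 / n\<close>, since \<open>V\<close> has norm at least \<open>n\<close>,
  while the weights sum to order \<open>n\<close>. Hence the exponential moment is bounded uniformly in \<open>n\<close> and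
  \<open>V\<close>.
\<close>

lemma nn_integral_exp_hit_weight_le:
  fixes \<epsilon> :: "nat \<Rightarrow> 'a \<Rightarrow> 'b::euclidean_space"
  assumes ind: "indep_vars (\<lambda>_. borel) \<epsilon> UNIV"
    and unif: "\<And>k. uniform_sphere_law (distr M borel (\<epsilon> k))"
    and a: "a > 1" and n: "n \<ge> 1" and V: "V \<in> lattice_shell n"
  shows "(\<integral>\<^sup>+\<omega>. ennreal (exp (2 * hit_weight a n (\<lambda>k. \<epsilon> k \<omega>) V)) \<partial>M)
          \<le> ennreal (exp (16 * real DIM('b) ^ 3 * (1 + 1 / (a - 1))))"
proof -
  have [measurable]: "\<epsilon> k \<in> borel_measurable M" for k
    using ind by (auto simp: indep_vars_def)
  define A where "A = {x :: 'b. \<bar>V \<bullet> x\<bar> \<le> real DIM('b)}"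
  have A[measurable]: "A \<in> sets borel" unfolding A_def by measurable
  define p where "p = 2 * real DIM('b) ^ 3 / real n"
  have prob: "prob (\<epsilon> k -` A \<inter> space M) \<le> p" for k
  proof -
    let ?\<mu> = "distr M borel (\<epsilon> k)"
    interpret D: prob_space ?\<mu> by (rule prob_space_distr) simp
    have Vn: "norm V \<ge> real n" and V0: "V \<noteq> 0"
      using norm_lattice_shell_ge[OF V] n by auto
    have "prob (\<epsilon> k -` A \<inter> space M) = measure ?\<mu> A" by (simp add: measure_distr)
    also have "\<dots> \<le> measure ?\<mu> {x. \<bar>((1 / norm V) *\<^sub>R V) \<bullet> x\<bar> \<le> real DIM('b) / real n}"
    proof (rule D.finite_measure_mono)
      show "A \<subseteq> {x. \<bar>((1 / norm V) *\<^sub>R V) \<bullet> x\<bar> \<le> real DIM('b) / real n}"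
      proof safe
        fix x assume "x \<in> A"
        then have "\<bar>V \<bullet> x\<bar> / norm V \<le> real DIM('b) / real n"
          using Vn n by (intro frac_le) (auto simp: A_def)
        then show "\<bar>((1 / norm V) *\<^sub>R V) \<bullet> x\<bar> \<le> real DIM('b) / real n" by (simp add: abs_mult)
      qed
      show "{x. \<bar>((1 / norm V) *\<^sub>R V) \<bullet> x\<bar> \<le> real DIM('b) / real n} \<in> sets ?\<mu>"
        unfolding sets_distr by measurable
    qed
    also have "\<dots> \<le> 2 * real DIM('b) ^ 2 * (real DIM('b) / real n)"
      using V0 by (intro uniform_sphere_law_slab_le unif) auto
    also have "\<dots> = p" by (simp add: p_def power2_eq_square power3_eq_cube)
    finally show ?thesis .
  qed
  let ?S = "\<lambda>m \<omega>. \<Sum>k<m. (2 * decay_weight a n k) * indicator A (\<epsilon> k \<omega>)"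
  have lim: "(\<lambda>m. ennreal (exp (?S m \<omega>))) \<longlonglongrightarrow> ennreal (exp (2 * hit_weight a n (\<lambda>k. \<epsilon> k \<omega>) V))" for \<omega>
    unfolding hit_weight_def A_def[symmetric] mult.assoc sum_distrib_left[symmetric]
    by (intro tendsto_mult tendsto_const tendsto_ennrealI tendsto_exp summable_LIMSEQ summable_hit_weight a n)
  have "(\<integral>\<^sup>+\<omega>. ennreal (exp (2 * hit_weight a n (\<lambda>k. \<epsilon> k \<omega>) V)) \<partial>M)
      = (\<integral>\<^sup>+\<omega>. liminf (\<lambda>m. ennreal (exp (?S m \<omega>))) \<partial>M)"
    by (intro nn_integral_cong lim_imp_Liminf[symmetric] lim) simp
  also have "\<dots> \<le> liminf (\<lambda>m. \<integral>\<^sup>+\<omega>. ennreal (exp (?S m \<omega>)) \<partial>M)"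
    by (intro nn_integral_liminf) measurable
  also have "\<dots> \<le> liminf (\<lambda>m. ennreal (exp (16 * real DIM('b) ^ 3 * (1 + 1 / (a - 1)))))"
  proof (intro Liminf_mono always_eventually allI)
    fix m
    have "(\<integral>\<^sup>+\<omega>. ennreal (exp (?S m \<omega>)) \<partial>M) \<le> ennreal (exp (4 * p * (\<Sum>k<m. 2 * decay_weight a n k)))"
      using a decay_weight_bounds[of a n] by (intro nn_integral_exp_weighted_count_le ind A prob) auto
    also have "4 * p * (\<Sum>k<m. 2 * decay_weight a n k) = 8 * p * (\<Sum>k<m. decay_weight a n k)"
      by (simp flip: sum_distrib_left)
    also have "ennreal (exp \<dots>) \<le> ennreal (exp (8 * p * (real n * (1 + 1 / (a - 1)))))"
      using a n by (intro ennreal_leI exp_le_cancel_iff[THEN iffD2] mult_left_mono sum_decay_weight_le)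
        (auto simp: p_def)
    also have "8 * p * (real n * (1 + 1 / (a - 1))) = 16 * real DIM('b) ^ 3 * (1 + 1 / (a - 1))"
      using n by (simp add: p_def)
    finally show "(\<integral>\<^sup>+\<omega>. ennreal (exp (?S m \<omega>)) \<partial>M) \<le> ennreal (exp (16 * real DIM('b) ^ 3 * (1 + 1 / (a - 1))))" .
  qed
  finally show ?thesis by (simp add: Liminf_const)
qed

text \<open>
  The shell has order \<open>n\<^sup>d\<^sup>-\<^sup>1\<close> points, so the expected cost has order \<open>n powr (d - 1 - s a)\<close> and tends
  to zero. By Fatou the lower limit of the costs vanishes almost surely, which suffices: a Hausdorff
  measure is bounded by coverings along any sequence of scales.
\<close>

lemma AE_shell_cost_arbitrarily_small:
  fixes \<epsilon> :: "nat \<Rightarrow> 'a \<Rightarrow> 'b::euclidean_space"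
  assumes ind: "indep_vars (\<lambda>_. borel) \<epsilon> UNIV"
    and unif: "\<And>k. uniform_sphere_law (distr M borel (\<epsilon> k))"
    and a: "a > 1" and s: "s * a > real (DIM('b) - 1)"
  shows "AE \<omega> in M. \<forall>\<eta>>0. \<exists>n\<ge>1. shell_cost s a n (\<lambda>k. \<epsilon> k \<omega>) < \<eta>"
proof -
  have [measurable]: "\<epsilon> k \<in> borel_measurable M" for k
    using ind by (auto simp: indep_vars_def)
  have [measurable]: "{x :: 'b. \<bar>V \<bullet> x\<bar> \<le> c} \<in> sets borel" for V c by measurable
  define N where "N = DIM('b) - 1"
  define C where "C = exp (16 * real DIM('b) ^ 3 * (1 + 1 / (a - 1)))"
  define Y where "Y n \<omega> = ennreal (shell_cost s a n (\<lambda>k. \<epsilon> k \<omega>))" for n \<omega>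
  have [measurable]: "(\<lambda>\<omega>. hit_weight a n (\<lambda>k. \<epsilon> k \<omega>) V) \<in> borel_measurable M" for n V
    unfolding hit_weight_def by measurable
  have [measurable]: "Y n \<in> borel_measurable M" for n
    unfolding Y_def shell_cost_def by measurable
  have EY: "(\<integral>\<^sup>+\<omega>. Y n \<omega> \<partial>M) \<le> ennreal (2 * real DIM('b) * 3 ^ N * C * real n powr (- (s * a - real N)))"
    if n: "n \<ge> 1" for n
  proof -
    have "(\<integral>\<^sup>+\<omega>. Y n \<omega> \<partial>M) = ennreal (real n powr (- (s * a))) *
        (\<integral>\<^sup>+\<omega>. (\<Sum>V\<in>lattice_shell n. ennreal (exp (2 * hit_weight a n (\<lambda>k. \<epsilon> k \<omega>) V))) \<partial>M)"
      unfolding Y_def shell_cost_def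
      by (subst nn_integral_cmult[symmetric]) (auto simp: ennreal_mult' sum_ennreal sum_nonneg)
    also have "\<dots> = ennreal (real n powr (- (s * a))) *
        (\<Sum>V\<in>lattice_shell n. \<integral>\<^sup>+\<omega>. ennreal (exp (2 * hit_weight a n (\<lambda>k. \<epsilon> k \<omega>) V)) \<partial>M)"
      by (subst nn_integral_sum) auto
    also have "\<dots> \<le> ennreal (real n powr (- (s * a))) * (\<Sum>V\<in>(lattice_shell n :: 'b set). ennreal C)"
      unfolding C_def
      by (intro mult_left_mono sum_mono nn_integral_exp_hit_weight_le ind unif a n) auto
    also have "\<dots> = ennreal (real n powr (- (s * a)) * (real (card (lattice_shell n :: 'b set)) * C))"
      by (simp add: C_def ennreal_mult' ennreal_of_nat_eq_real_of_nat)
    also have "\<dots> \<le> ennreal (2 * real DIM('b) * 3 ^ N * C * real n powr (- (s * a - real N)))"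
    proof (rule ennreal_leI)
      have "real (card (lattice_shell n :: 'b set)) \<le> real (2 * DIM('b) * (2 * n + 1) ^ N)"
        unfolding N_def by (intro of_nat_mono lattice_shell_finite_card)
      also have "\<dots> \<le> 2 * real DIM('b) * (3 * real n) ^ N"
        unfolding of_nat_mult of_nat_power using n by (intro mult_mono power_mono) auto
      also have "\<dots> = 2 * real DIM('b) * 3 ^ N * real n powr real N"
        using n by (simp add: powr_realpow power_mult_distrib)
      finally have "real n powr (- (s * a)) * (real (card (lattice_shell n :: 'b set)) * C)
          \<le> real n powr (- (s * a)) * (2 * real DIM('b) * 3 ^ N * real n powr real N * C)"
        by (intro mult_left_mono mult_right_mono) (auto simp: C_def)
      also have "\<dots> = 2 * real DIM('b) * 3 ^ N * C * (real n powr (- (s * a)) * real n powr real N)"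
        by simp
      also have "real n powr (- (s * a)) * real n powr real N = real n powr (- (s * a - real N))"
        by (simp flip: powr_add)
      finally show "real n powr (- (s * a)) * (real (card (lattice_shell n :: 'b set)) * C)
         \<le> 2 * real DIM('b) * 3 ^ N * C * real n powr (- (s * a - real N))" .
    qed
    finally show ?thesis .
  qed
  have "(\<lambda>n. ennreal (2 * real DIM('b) * 3 ^ N * C * real n powr (- (s * a - real N))))
      \<longlonglongrightarrow> ennreal (2 * real DIM('b) * 3 ^ N * C * 0)"
    using s by (intro tendsto_ennrealI tendsto_mult tendsto_const tendsto_neg_powr
        filterlim_real_sequentially) (simp add: N_def)
  then have "(\<lambda>n. \<integral>\<^sup>+\<omega>. Y n \<omega> \<partial>M) \<longlonglongrightarrow> 0"
    by (intro tendsto_sandwich[of "\<lambda>_. 0" _ sequentially, OF _ eventually_mono[OF eventually_ge_at_top[of 1] EY]])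
       auto
  then have "liminf (\<lambda>n. \<integral>\<^sup>+\<omega>. Y n \<omega> \<partial>M) = 0" by (intro lim_imp_Liminf) auto
  moreover have "(\<integral>\<^sup>+\<omega>. liminf (\<lambda>n. Y n \<omega>) \<partial>M) \<le> liminf (\<lambda>n. \<integral>\<^sup>+\<omega>. Y n \<omega> \<partial>M)"
    by (intro nn_integral_liminf) simp
  ultimately have "(\<integral>\<^sup>+\<omega>. liminf (\<lambda>n. Y n \<omega>) \<partial>M) = 0" by simp
  then have "AE \<omega> in M. liminf (\<lambda>n. Y n \<omega>) = 0"
    by (subst (asm) nn_integral_0_iff_AE) auto
  then show ?thesis
  proof eventually_elim
    case (elim \<omega>)
    show ?case
    proof (intro allI impI, rule ccontr)
      fix \<eta> :: real assume \<eta>: "\<eta> > 0" and no: "\<not> (\<exists>n\<ge>1. shell_cost s a n (\<lambda>k. \<epsilon> k \<omega>) < \<eta>)"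
      have "\<forall>\<^sub>F n in sequentially. ennreal \<eta> \<le> Y n \<omega>"
        using eventually_ge_at_top[of 1]
        by eventually_elim (use no in \<open>auto simp: Y_def not_less intro!: ennreal_leI\<close>)
      then have "ennreal \<eta> \<le> liminf (\<lambda>n. Y n \<omega>)" by (rule Liminf_bounded)
      with elim \<eta> show False by simp
    qed
  qed
qed

end

section \<open>Hausdorff measure and dimension\<close>

lemma hausdorff_measure_mono:
  assumes "A \<subseteq> B" shows "hausdorff_measure s A \<le> hausdorff_measure s B"
  unfolding hausdorff_measure_def hausdorff_premeasure_def
  using assms by (intro SUP_mono' INF_superset_mono) auto

lemma hausdorff_dim_leI:
  assumes "0 \<le> s" "hausdorff_measure s A = 0" shows "hausdorff_dim A \<le> ennreal s"
  unfolding hausdorff_dim_def using assms by (intro INF_lower) auto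

lemma hausdorff_dim_mono:
  assumes "A \<subseteq> B" shows "hausdorff_dim A \<le> hausdorff_dim B"
  unfolding hausdorff_dim_def
proof (rule INF_superset_mono)
  show "{s. 0 \<le> s \<and> hausdorff_measure s B = 0} \<subseteq> {s. 0 \<le> s \<and> hausdorff_measure s A = 0}"
    using hausdorff_measure_mono[OF assms] by (auto intro: le_zero_eq[THEN iffD1] dest: eq_refl order_trans)
qed simp

text \<open>
  The bound \<open>\<delta>\<close> on the diameters comes for free: when the sum of their \<open>s\<close>-th powers is at most
  \<open>\<delta> powr s\<close> and \<open>s > 0\<close>, every single diameter is at most \<open>\<delta>\<close>.
\<close>

lemma hausdorff_measure_eq_0I:
  fixes A :: "'a::metric_space set"
  assumes s: "s > 0"
    and cover: "\<And>\<eta>. \<eta> > 0 \<Longrightarrow> \<exists>(I :: 'i set) c. finite I \<and> A \<subseteq> (\<Union>i\<in>I. c i) \<and> (\<forall>i\<in>I. bounded (c i)) \<and>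
                     (\<Sum>i\<in>I. diameter (c i) powr s) \<le> \<eta>"
  shows "hausdorff_measure s A = 0"
proof -
  have "hausdorff_premeasure s \<delta> A \<le> 0" if \<delta>: "\<delta> > 0" for \<delta>
  proof (rule ennreal_le_epsilon)
    fix e :: real assume "e > 0"
    define \<eta> where "\<eta> = min e (\<delta> powr s)"
    have "\<eta> > 0" using \<open>e > 0\<close> \<delta> by (simp add: \<eta>_def)
    from cover[OF this] obtain I :: "'i set" and c where I: "finite I" "A \<subseteq> (\<Union>i\<in>I. c i)"
      "\<And>i. i \<in> I \<Longrightarrow> bounded (c i)" and sum: "(\<Sum>i\<in>I. diameter (c i) powr s) \<le> \<eta>" by blast
    obtain h where h: "bij_betw h {0..<card I} I" using ex_bij_betw_nat_finite[OF I(1)] by blast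
    define U where "U k = (if k < card I then c (h k) else {})" for k
    have hI: "h k \<in> I" if "k < card I" for k using h that by (auto simp: bij_betw_def)
    have diam: "diameter (c i) \<le> \<delta>" if "i \<in> I" for i
    proof -
      have "diameter (c i) powr s \<le> (\<Sum>i\<in>I. diameter (c i) powr s)"
        using I(1) that by (intro member_le_sum) auto
      also have "\<dots> \<le> \<delta> powr s" using sum by (simp add: \<eta>_def)
      finally show ?thesis
        using s \<delta> powr_less_mono2[of s \<delta> "diameter (c i)"] by force
    qed
    have "A \<subseteq> (\<Union>k. U k)"
    proof
      fix x assume "x \<in> A"
      then obtain i where "i \<in> I" "x \<in> c i" using I(2) by blast
      moreover then obtain k where "k < card I" "i = h k"
        using h unfolding bij_betw_def by (metis atLeastLessThan_iff imageE)
      ultimately show "x \<in> (\<Union>k. U k)" by (auto simp: U_def intro!: exI[of _ k])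
    qed
    moreover have "bounded (U k) \<and> diameter (U k) \<le> \<delta>" for k
      using I(3) hI diam \<delta> by (auto simp: U_def)
    ultimately have "hausdorff_premeasure s \<delta> A \<le> (\<Sum>k. diam_power s (U k))"
      unfolding hausdorff_premeasure_def by (intro INF_lower) auto
    also have "\<dots> = (\<Sum>k<card I. diam_power s (U k))"
      by (intro suminf_finite) (auto simp: U_def diam_power_def)
    also have "\<dots> \<le> (\<Sum>k<card I. ennreal (diameter (c (h k)) powr s))"
      using s by (intro sum_mono) (auto simp: U_def diam_power_def)
    also have "\<dots> = ennreal (\<Sum>k<card I. diameter (c (h k)) powr s)" by (intro sum_ennreal) auto
    also have "(\<Sum>k<card I. diameter (c (h k)) powr s) = (\<Sum>i\<in>I. diameter (c i) powr s)"
      using sum.reindex_bij_betw[OF h, of "\<lambda>i. diameter (c i) powr s"] by (simp add: atLeast0LessThan)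
    also have "ennreal \<dots> \<le> 0 + ennreal e" using sum by (auto simp: \<eta>_def intro!: ennreal_leI)
    finally show "hausdorff_premeasure s \<delta> A \<le> 0 + ennreal e" .
  qed
  then have "hausdorff_measure s A \<le> 0"
    unfolding hausdorff_measure_def by (intro SUP_least) auto
  then show ?thesis by simp
qed

text \<open>
  The cone over the cube of side \<open>2\<close> around \<open>V\<close>; a cone, because the field depends only on the
  direction of its argument.
\<close>

section \<open>Covering the image of the field\<close>

lemma power_le_fact_mult_exp:
  fixes x :: real
  assumes "x \<ge> 0" shows "x ^ m \<le> fact m * exp x"
proof -
  have s: "(\<lambda>k. x ^ k / fact k) sums exp x"
    using exp_converges[of x] by (simp add: divide_inverse mult.commute)
  have "(\<Sum>k\<in>{m}. x ^ k / fact k) \<le> (\<Sum>k. x ^ k / fact k)"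
    using assms sums_summable[OF s] by (intro sum_le_suminf) auto
  then have "x ^ m / fact m \<le> exp x" using sums_unique[OF s] by simp
  then show ?thesis by (simp add: field_simps)
qed

lemma powr_le_fact_mult_exp:
  fixes W s :: real
  assumes "W \<ge> 0" "s > 0"
  shows "W powr s \<le> fact (nat \<lceil>s\<rceil>) * exp 1 * exp W"
proof -
  have "W powr s \<le> (W + 1) powr s" using assms by (intro powr_mono2) auto
  also have "\<dots> \<le> (W + 1) powr real (nat \<lceil>s\<rceil>)" using assms by (intro powr_mono) auto
  also have "\<dots> = (W + 1) ^ nat \<lceil>s\<rceil>" using assms by (intro powr_realpow) auto
  also have "\<dots> \<le> fact (nat \<lceil>s\<rceil>) * exp (W + 1)"
    using assms by (intro power_le_fact_mult_exp) auto
  finally show ?thesis by (simp add: exp_add mult_ac)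
qed

definition direction_cell :: "'a::euclidean_space \<Rightarrow> 'a set" where
  "direction_cell V = {u. \<exists>c>0. \<forall>i\<in>Basis. \<bar>(c *\<^sub>R u - V) \<bullet> i\<bar> \<le> 1}"

text \<open>
  After scaling, \<open>u\<close> differs from \<open>V\<close> by at most \<open>1\<close> in each of the \<open>d\<close> coordinates, so the inner
  product with \<open>x\<close> changes by at most \<open>d\<close> and cannot change sign.
\<close>

lemma direction_cell_sign:
  fixes x :: "'a::euclidean_space"
  assumes u: "u \<in> direction_cell V" and x: "norm x \<le> 1" and far: "\<bar>V \<bullet> x\<bar> > real DIM('a)"
  shows "u \<bullet> x > 0 \<longleftrightarrow> V \<bullet> x > 0"
proof -
  obtain c where c: "c > 0" "\<And>i. i \<in> Basis \<Longrightarrow> \<bar>(c *\<^sub>R u - V) \<bullet> i\<bar> \<le> 1"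
    using u by (auto simp: direction_cell_def)
  have "\<bar>(c *\<^sub>R u - V) \<bullet> x\<bar> = \<bar>\<Sum>i\<in>Basis. ((c *\<^sub>R u - V) \<bullet> i) * (x \<bullet> i)\<bar>"
    by (subst euclidean_inner) simp
  also have "\<dots> \<le> (\<Sum>i\<in>Basis. \<bar>((c *\<^sub>R u - V) \<bullet> i) * (x \<bullet> i)\<bar>)" by (rule sum_abs)
  also have "\<dots> \<le> (\<Sum>i\<in>(Basis::'a set). 1 * 1)"
    unfolding abs_mult using c(2) x by (intro sum_mono mult_mono) (auto intro: order_trans[OF Basis_le_norm])
  finally have "\<bar>c * (u \<bullet> x) - V \<bullet> x\<bar> \<le> real DIM('a)" by (simp add: inner_diff_left)
  with far have "c * (u \<bullet> x) > 0 \<longleftrightarrow> V \<bullet> x > 0" by linarith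
  with c(1) show ?thesis by (simp add: zero_less_mult_iff)
qed

definition pos_pattern :: "(nat \<Rightarrow> 'a::euclidean_space) \<Rightarrow> nat \<Rightarrow> 'a \<Rightarrow> nat set" where
  "pos_pattern e n u = {k. k < n \<and> u \<bullet> e k > 0}"

text \<open>
  The field and the zonoid for one fixed realisation of the jump sizes and directions.
\<close>

locale jump_series =
  fixes g :: "nat \<Rightarrow> real" and e :: "nat \<Rightarrow> 'a::euclidean_space"
  assumes g_nonneg: "0 \<le> g k" and g_summable: "summable g" and e_norm: "norm (e k) \<le> 1"
begin

definition X :: "'a \<Rightarrow> 'a" where
  "X u = (\<Sum>k. (g k * indicator {v. u \<bullet> v > 0} (e k)) *\<^sub>R e k)"

lemma X_summable: "summable (\<lambda>k. (g k * indicator {v. u \<bullet> v > 0} (e k)) *\<^sub>R e k)"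
  using g_nonneg e_norm
  by (intro summable_comparison_test'[OF g_summable, of 0])
     (auto simp: indicator_def abs_mult mult_left_le)

lemma X_scale: "c > 0 \<Longrightarrow> X (c *\<^sub>R u) = X u"
  by (simp add: X_def indicator_def zero_less_mult_iff)

text \<open>
  Equal patterns cancel the first \<open>n\<close> terms, and a later term can differ only if its hyperplane
  passes near \<open>V\<close>. Bounding the difference by the jumps near \<open>V\<close> instead of the whole tail
  \<open>\<Sum>k\<ge>n. g k\<close> is the decisive gain: the tail has order \<open>n powr (1 - a)\<close>, the bound here typically
  \<open>n powr (- a)\<close>.
\<close>

lemma dist_X_le_hit_weight:
  assumes a: "a > 1" and n: "n \<ge> 1" and C: "\<And>k. g k \<le> C * (real k + 1) powr (- a)"
    and u: "u \<in> direction_cell V" "u' \<in> direction_cell V"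
    and pat: "pos_pattern e n u = pos_pattern e n u'"
  shows "norm (X u - X u') \<le> C * real n powr (- a) * hit_weight a n e V"
proof -
  let ?A = "{x :: 'a. \<bar>V \<bullet> x\<bar> \<le> real DIM('a)}"
  let ?t = "\<lambda>u k. (g k * indicator {v. u \<bullet> v > 0} (e k)) *\<^sub>R e k"
  have C0: "C \<ge> 0" using order_trans[OF g_nonneg C, of 0] by simp
  have jump: "norm (?t u k - ?t u' k) \<le> C * real n powr (- a) * (decay_weight a n k * indicator ?A (e k))" for k
  proof (cases "k < n \<or> e k \<notin> ?A")
    case True
    then have "u \<bullet> e k > 0 \<longleftrightarrow> u' \<bullet> e k > 0"
    proof
      assume "k < n"
      then have "k \<in> pos_pattern e n w \<longleftrightarrow> w \<bullet> e k > 0" for w by (simp add: pos_pattern_def)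
      then show ?thesis using pat by blast
    next
      assume "e k \<notin> ?A" then show ?thesis
        using direction_cell_sign[OF u(1) e_norm[of k]] direction_cell_sign[OF u(2) e_norm[of k]]
        by (metis mem_Collect_eq not_le)
    qed
    then have eq: "?t u k = ?t u' k" unfolding indicator_def by simp
    show ?thesis unfolding eq using C0 decay_weight_bounds(1)[of a n k] a by simp
  next
    case False
    have "norm (?t u k - ?t u' k) \<le> g k"
      using g_nonneg[of k] e_norm[of k] by (auto simp: indicator_def abs_mult mult_left_le)
    also have "\<dots> \<le> C * (real k + 1) powr (- a)" by (rule C)
    also have "(real k + 1) powr (- a) = real n powr (- a) * (real n / (real k + 1)) powr a"
      using n by (simp add: powr_divide powr_minus_divide)
    finally show ?thesis using False by (simp add: decay_weight_def mult_ac)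
  qed
  have sm: "summable (\<lambda>k. C * real n powr (- a) * (decay_weight a n k * indicator ?A (e k)))"
    by (intro summable_mult summable_hit_weight a n)
  have "X u - X u' = (\<Sum>k. ?t u k - ?t u' k)"
    unfolding X_def by (intro suminf_diff X_summable)
  also have "norm \<dots> \<le> (\<Sum>k. norm (?t u k - ?t u' k))"
    by (intro summable_norm summable_comparison_test'[OF sm, of 0]) (use jump in auto)
  also have "\<dots> \<le> (\<Sum>k. C * real n powr (- a) * (decay_weight a n k * indicator ?A (e k)))"
    by (intro suminf_le jump sm summable_comparison_test'[OF sm, of 0]) (use jump in auto)
  also have "\<dots> = C * real n powr (- a) * hit_weight a n e V"
    unfolding hit_weight_def by (intro suminf_mult summable_hit_weight a n)
  finally show ?thesis .
qed

text \<open>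
  On a cell only the hyperplanes near \<open>V\<close> can separate points, and the first \<open>n\<close> weights are \<open>1\<close>,
  so the number of those among the first \<open>n\<close> is at most the hit weight. The crude bound by the number
  of subsets suffices, because exponential moments of the hit weight are under control.
\<close>

lemma card_pos_pattern_cell_le:
  assumes a: "a > 1" and n: "n \<ge> 1"
  shows "real (card (pos_pattern e n ` direction_cell V)) \<le> exp (hit_weight a n e V)"
proof -
  let ?A = "{x :: 'a. \<bar>V \<bullet> x\<bar> \<le> real DIM('a)}"
  define H where "H = {k. k < n \<and> e k \<in> ?A}"
  define R where "R = {k. k < n \<and> e k \<notin> ?A \<and> V \<bullet> e k > 0}"
  have finH: "finite H" by (simp add: H_def)
  have eq: "pos_pattern e n u = (pos_pattern e n u \<inter> H) \<union> R" if "u \<in> direction_cell V" for u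
  proof -
    have "u \<bullet> e k > 0 \<longleftrightarrow> V \<bullet> e k > 0" if "e k \<notin> ?A" for k
      using direction_cell_sign[OF \<open>u \<in> direction_cell V\<close> e_norm[of k]] that by (simp add: not_le)
    then show ?thesis unfolding pos_pattern_def H_def R_def by blast
  qed
  have "pos_pattern e n ` direction_cell V \<subseteq> (\<lambda>S. S \<union> R) ` Pow H"
    using eq by blast
  then have "card (pos_pattern e n ` direction_cell V) \<le> card (Pow H)"
    using finH by (intro surj_card_le) auto
  then have "real (card (pos_pattern e n ` direction_cell V)) \<le> 2 ^ card H"
    using finH by (simp add: card_Pow)
  also have "\<dots> \<le> exp 1 ^ card H" using exp_ge_add_one_self[of 1] by (intro power_mono) auto
  also have "\<dots> = exp (real (card H))" by (simp flip: exp_of_nat_mult)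
  also have "\<dots> \<le> exp (hit_weight a n e V)"
  proof (rule exp_le_cancel_iff[THEN iffD2])
    have "real (card H) = (\<Sum>k\<in>H. decay_weight a n k * indicator ?A (e k))"
      by (subst sum.cong[OF refl, where h = "\<lambda>_. 1"]) (auto simp: H_def decay_weight_def)
    also have "\<dots> \<le> hit_weight a n e V"
      unfolding hit_weight_def using finH a decay_weight_bounds
      by (intro sum_le_suminf summable_hit_weight a n) auto
    finally show "real (card H) \<le> hit_weight a n e V" .
  qed
  finally show ?thesis .
qed

text \<open>
  The image is covered by the closures of the images of the pattern classes in the cells. There are
  finitely many, so they cover the closure of the image too.
\<close>

lemma hausdorff_measure_closure_X_eq_0:
  assumes a: "a > 1" and s: "s > 0" and C: "\<And>k. g k \<le> C * (real k + 1) powr (- a)"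
    and cost: "\<forall>\<eta>>0. \<exists>n\<ge>1. shell_cost s a n e < \<eta>"
  shows "hausdorff_measure s (closure (X ` sphere 0 1)) = 0"
proof (rule hausdorff_measure_eq_0I[OF s, where 'i = "'a \<times> nat set"])
  fix \<eta> :: real assume \<eta>: "\<eta> > 0"
  \<comment> \<open>Only \<open>C \<ge> 0\<close> is known, and \<open>K\<close> below has to be positive.\<close>
  define C' where "C' = C + 1"
  have C0: "C' > 0" using order_trans[OF g_nonneg C, of 0] by (simp add: C'_def)
  have C': "g k \<le> C' * (real k + 1) powr (- a)" for k
    using C[of k] by (rule order_trans) (auto simp: C'_def intro: mult_right_mono)
  define K where "K = C' powr s * (fact (nat \<lceil>s\<rceil>) * exp 1)"
  have K0: "K > 0" using C0 by (simp add: K_def)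
  obtain n where n: "n \<ge> 1" "shell_cost s a n e < \<eta> / K"
    using cost \<eta> K0 by (meson divide_pos_pos)
  define P where "P V = pos_pattern e n ` direction_cell V" for V
  define c where "c = (\<lambda>(V, S). closure (X ` {u \<in> direction_cell V. pos_pattern e n u = S}))"
  define D where "D V = C' * real n powr (- a) * hit_weight a n e V" for V
  have W0: "hit_weight a n e V \<ge> 0" for V
    unfolding hit_weight_def using decay_weight_bounds(1)[of a n] a by (intro suminf_nonneg summable_hit_weight n a) auto
  have D0: "D V \<ge> 0" for V using W0[of V] C0 by (simp add: D_def)
  have finP: "finite (P V)" for V
    unfolding P_def by (rule finite_subset[of _ "Pow {..<n}"]) (auto simp: pos_pattern_def)
  have near: "norm (x - y) \<le> D V" if "x \<in> X ` {u \<in> direction_cell V. pos_pattern e n u = S}"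
    "y \<in> X ` {u \<in> direction_cell V. pos_pattern e n u = S}" for x y V S
    using that dist_X_le_hit_weight[OF a n(1) C'] by (auto simp: D_def)
  have bdd: "bounded (X ` {u \<in> direction_cell V. pos_pattern e n u = S})" for V S
    unfolding bounded_two_points dist_norm using near[of _ V S] by (intro exI[of _ "D V"] ballI)
  have diam: "diameter (c (V, S)) \<le> D V" for V S
    unfolding c_def prod.case diameter_closure[OF bdd] using near D0 by (intro diameter_le) auto
  let ?I = "Sigma (lattice_shell n) P"
  have finI: "finite ?I" using lattice_shell_finite_card(1) finP by (intro finite_SigmaI)
  have "X ` sphere 0 1 \<subseteq> (\<Union>i\<in>?I. c i)"
  proof
    fix x assume "x \<in> X ` sphere 0 1"
    then obtain u where u: "norm u = 1" "x = X u" by auto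
    obtain b V where V: "b > 0" "V \<in> lattice_shell n" "\<forall>i\<in>Basis. \<bar>(b *\<^sub>R u - V) \<bullet> i\<bar> \<le> 1"
    proof (rule lattice_shell_covers_directions[of u n])
      show "u \<noteq> 0" using u(1) by auto
      show "0 < n" using n(1) by simp
    qed blast
    then have "u \<in> direction_cell V" unfolding direction_cell_def by blast
    then have "(V, pos_pattern e n u) \<in> ?I" "x \<in> c (V, pos_pattern e n u)"
      using V u by (auto simp: P_def c_def intro!: subsetD[OF closure_subset])
    then show "x \<in> (\<Union>i\<in>?I. c i)" by blast
  qed
  moreover have "closed (\<Union>i\<in>?I. c i)" using finI by (intro closed_UN) (auto simp: c_def)
  ultimately have cover: "closure (X ` sphere 0 1) \<subseteq> (\<Union>i\<in>?I. c i)" by (rule closure_minimal)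
  have "(\<Sum>i\<in>?I. diameter (c i) powr s) = (\<Sum>V\<in>lattice_shell n. \<Sum>S\<in>P V. diameter (c (V, S)) powr s)"
    using lattice_shell_finite_card(1) finP by (subst sum.Sigma) auto
  also have "\<dots> \<le> (\<Sum>V\<in>lattice_shell n. K * (real n powr (- (s * a)) * exp (2 * hit_weight a n e V)))"
  proof (rule sum_mono)
    fix V
    let ?W = "hit_weight a n e V"
    have "(\<Sum>S\<in>P V. diameter (c (V, S)) powr s) \<le> (\<Sum>S\<in>P V. D V powr s)"
      using s by (intro sum_mono powr_mono2 diam diameter_ge_0) (simp_all add: c_def bdd bounded_closure)
    also have "\<dots> = real (card (P V)) * D V powr s" by simp
    also have "\<dots> \<le> exp ?W * D V powr s"
      unfolding P_def by (intro mult_right_mono card_pos_pattern_cell_le a n) auto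
    also have "D V powr s = C' powr s * real n powr (- (s * a)) * ?W powr s"
      using W0[of V] C0 by (simp add: D_def powr_mult powr_powr mult.commute)
    also have "exp ?W * (C' powr s * real n powr (- (s * a)) * ?W powr s)
        \<le> exp ?W * (C' powr s * real n powr (- (s * a)) * (fact (nat \<lceil>s\<rceil>) * exp 1 * exp ?W))"
      using W0[of V] s by (intro mult_left_mono powr_le_fact_mult_exp) auto
    also have "\<dots> = K * (real n powr (- (s * a)) * (exp ?W * exp ?W))" by (simp add: K_def)
    also have "exp ?W * exp ?W = exp (2 * ?W)" by (simp flip: exp_add)
    finally show "(\<Sum>S\<in>P V. diameter (c (V, S)) powr s) \<le> K * (real n powr (- (s * a)) * exp (2 * ?W))" .
  qed
  also have "\<dots> = K * shell_cost s a n e" by (simp add: shell_cost_def sum_distrib_left)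
  also have "\<dots> \<le> \<eta>" using mult_left_mono[OF less_imp_le[OF n(2)], of K] K0 by simp
  finally have sum: "(\<Sum>i\<in>?I. diameter (c i) powr s) \<le> \<eta>" .
  show "\<exists>(I :: ('a \<times> nat set) set) c. finite I \<and> closure (X ` sphere 0 1) \<subseteq> (\<Union>i\<in>I. c i) \<and>
      (\<forall>i\<in>I. bounded (c i)) \<and> (\<Sum>i\<in>I. diameter (c i) powr s) \<le> \<eta>"
    using finI cover sum bdd by (intro exI[of _ ?I] exI[of _ c]) (auto simp: c_def)
qed

end

section \<open>The zonoid as a convex hull\<close>

lemma infdist_le_hausdorff_dist:
  fixes A B :: "'a::metric_space set"
  assumes "compact A" "compact B"
  shows "x \<in> A \<Longrightarrow> infdist x B \<le> hausdorff_dist A B"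
    and "x \<in> B \<Longrightarrow> infdist x A \<le> hausdorff_dist A B"
proof -
  have bdd: "bdd_above ((\<lambda>a. infdist a B) ` A)" if "compact A" for A B :: "'a set"
    using that by (intro bounded_imp_bdd_above compact_imp_bounded compact_continuous_image continuous_intros)
  show "x \<in> A \<Longrightarrow> infdist x B \<le> hausdorff_dist A B"
    unfolding hausdorff_dist_def using cSUP_upper[OF _ bdd[OF assms(1)], of x B] by linarith
  show "x \<in> B \<Longrightarrow> infdist x A \<le> hausdorff_dist A B"
    unfolding hausdorff_dist_def using cSUP_upper[OF _ bdd[OF assms(2)], of x A] by linarith
qed

lemma infdist_triangle_le:
  assumes "B \<noteq> {}" "infdist x B \<le> r" "\<And>b. b \<in> B \<Longrightarrow> infdist b C \<le> s"
  shows "infdist x C \<le> r + s"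
proof (rule field_le_epsilon)
  fix d :: real assume "d > 0"
  have "\<exists>b\<in>B. dist x b < r + d"
  proof (rule ccontr)
    assume "\<not> ?thesis"
    then have "r + d \<le> infdist x B"
      unfolding infdist_notempty[OF assms(1)] using assms(1) by (intro cINF_greatest) (auto simp: not_less)
    with assms(2) \<open>d > 0\<close> show False by linarith
  qed
  then obtain b where "b \<in> B" "dist x b < r + d" by blast
  with infdist_triangle[of x C b] assms(3)[of b] show "infdist x C \<le> r + s + d" by linarith
qed

text \<open>
  Two limits of the same sequence are at infimum distance zero from each other's points by the
  triangle inequality, hence equal, as both are closed.
\<close>

lemma hausdorff_lim_eqI:
  fixes K :: "nat \<Rightarrow> 'a::metric_space set"
  assumes K: "\<And>n. compact (K n)" "\<And>n. K n \<noteq> {}"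
    and L: "compact L" "L \<noteq> {}" "(\<lambda>n. hausdorff_dist (K n) L) \<longlonglongrightarrow> 0"
  shows "hausdorff_lim K = L"
  unfolding hausdorff_lim_def
proof (rule the_equality)
  have sub: "A \<subseteq> B" if A: "compact A" "(\<lambda>n. hausdorff_dist (K n) A) \<longlonglongrightarrow> 0"
    and B: "compact B" "B \<noteq> {}" "(\<lambda>n. hausdorff_dist (K n) B) \<longlonglongrightarrow> 0" for A B
  proof
    fix x assume x: "x \<in> A"
    have "infdist x B \<le> hausdorff_dist (K n) A + hausdorff_dist (K n) B" for n
      using K infdist_le_hausdorff_dist(2)[OF K(1) A(1) x] infdist_le_hausdorff_dist(1)[OF K(1) B(1)]
      by (intro infdist_triangle_le[of "K n"]) auto
    moreover have "(\<lambda>n. hausdorff_dist (K n) A + hausdorff_dist (K n) B) \<longlonglongrightarrow> 0 + 0"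
      by (intro tendsto_add A B)
    ultimately have "infdist x B \<le> 0 + 0" by (intro LIMSEQ_le_const) auto
    then have "infdist x B = 0" using infdist_nonneg[of x B] by linarith
    then show "x \<in> B" using in_closed_iff_infdist_zero[OF compact_imp_closed[OF B(1)] B(2)] by blast
  qed
  fix L' assume "compact L' \<and> L' \<noteq> {} \<and> (\<lambda>n. hausdorff_dist (K n) L') \<longlonglongrightarrow> 0"
  then show "L' = L" using L sub[of L L'] sub[of L' L] by blast
qed (use L in blast)

lemma compact_set_plus:
  fixes S T :: "'a::real_normed_vector set"
  assumes "compact S" "compact T" shows "compact (S + T)"
proof -
  have "S + T = {x + y | x y. x \<in> S \<and> y \<in> T}" by (auto simp: set_plus_def)
  then show ?thesis using compact_sums[OF assms] by simp
qed

context jump_series begin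

definition Z :: "nat \<Rightarrow> 'a set" where
  "Z n = (\<Sum>k<n. (*\<^sub>R) (g k) ` closed_segment 0 (e k))"

definition X_part :: "nat \<Rightarrow> 'a \<Rightarrow> 'a" where
  "X_part n u = (\<Sum>k<n. (g k * indicator {v. u \<bullet> v > 0} (e k)) *\<^sub>R e k)"

definition tail :: "nat \<Rightarrow> real" where "tail n = (\<Sum>k. g (k + n))"

lemma compact_Z: "compact (Z n)"
proof (induction n)
  case 0
  then show ?case by (simp add: Z_def set_zero)
next
  case (Suc n)
  then show ?case by (simp add: Z_def compact_set_plus compact_scaling)
qed

lemma convex_Z: "convex (Z n)"
  unfolding Z_def by (intro convex_set_sum convex_scaling convex_closed_segment)

lemma X_part_in_Z: "X_part n u \<in> Z n"
proof -
  have "(g k * indicator {v. u \<bullet> v > 0} (e k)) *\<^sub>R e k \<in> (*\<^sub>R) (g k) ` closed_segment 0 (e k)" for k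
    by (intro image_eqI[of _ _ "indicator {v. u \<bullet> v > 0} (e k) *\<^sub>R e k"]) (auto simp: indicator_def)
  then show ?thesis unfolding Z_def X_part_def by (subst set_sum_alt) auto
qed

lemma norm_X_minus_X_part: "norm (X u - X_part n u) \<le> tail n"
proof -
  have "X u - X_part n u = (\<Sum>k. (g (k + n) * indicator {v. u \<bullet> v > 0} (e (k + n))) *\<^sub>R e (k + n))"
    unfolding X_def X_part_def by (rule suminf_minus_initial_segment[OF X_summable, symmetric])
  also have "norm \<dots> \<le> tail n"
    unfolding tail_def
  proof (rule norm_suminf_le)
    fix k
    show "norm ((g (k + n) * indicator {v. u \<bullet> v > 0} (e (k + n))) *\<^sub>R e (k + n)) \<le> g (k + n)"
      using g_nonneg[of "k + n"] e_norm[of "k + n"] by (auto simp: indicator_def abs_mult mult_left_le)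
  qed (use g_summable in \<open>simp add: summable_iff_shift\<close>)
  finally show ?thesis .
qed

lemma tail_nonneg: "0 \<le> tail n"
  unfolding tail_def using g_summable g_nonneg by (intro suminf_nonneg) (auto simp: summable_iff_shift)

lemma tail_tendsto_0: "tail \<longlonglongrightarrow> 0"
proof -
  have "(\<lambda>n. suminf g - (\<Sum>k<n. g k)) \<longlonglongrightarrow> suminf g - suminf g"
    by (intro tendsto_diff tendsto_const summable_LIMSEQ g_summable)
  moreover have "tail = (\<lambda>n. suminf g - (\<Sum>k<n. g k))"
    by (simp add: tail_def fun_eq_iff suminf_minus_initial_segment[OF g_summable])
  ultimately show ?thesis by simp
qed

text \<open>
  In direction \<open>u\<close> each segment is maximised by its endpoint \<open>g k *\<^sub>R e k\<close> or by \<open>0\<close>, according to the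
  sign of \<open>u \<bullet> e k\<close>. This choice is the \<open>k\<close>-th term of \<open>X u\<close>.
\<close>

lemma inner_le_inner_X:
  assumes "x \<in> Z n" shows "u \<bullet> x \<le> u \<bullet> X u"
proof -
  let ?t = "\<lambda>k. (g k * indicator {v. u \<bullet> v > 0} (e k)) *\<^sub>R e k"
  have t0: "0 \<le> u \<bullet> ?t k" for k using g_nonneg[of k] by (simp add: indicator_def)
  obtain s where s: "x = (\<Sum>k<n. s k)" "\<And>k. k < n \<Longrightarrow> s k \<in> (*\<^sub>R) (g k) ` closed_segment 0 (e k)"
    using assms unfolding Z_def by (auto simp: set_sum_alt)
  have le: "u \<bullet> s k \<le> u \<bullet> ?t k" if k: "k < n" for k
  proof -
    obtain c where c: "0 \<le> c" "c \<le> 1" "s k = g k *\<^sub>R (c *\<^sub>R e k)"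
      using s(2)[OF k] by (auto simp: in_segment)
    have "c * (u \<bullet> e k) \<le> indicator {v. u \<bullet> v > 0} (e k) * (u \<bullet> e k)"
      using c by (auto simp: indicator_def mult_left_le_one_le mult_nonneg_nonpos)
    from mult_left_mono[OF this g_nonneg[of k]] show ?thesis by (simp add: c mult.assoc)
  qed
  have "u \<bullet> x = (\<Sum>k<n. u \<bullet> s k)" by (simp add: s inner_sum_right)
  also have "\<dots> \<le> (\<Sum>k<n. u \<bullet> ?t k)" using le by (intro sum_mono) auto
  also have "\<dots> \<le> (\<Sum>k. u \<bullet> ?t k)"
    using t0 by (intro sum_le_suminf bounded_linear.summable[OF bounded_linear_inner_right] X_summable) auto
  also have "\<dots> = u \<bullet> X u"
    unfolding X_def by (rule bounded_linear.suminf[OF bounded_linear_inner_right X_summable, symmetric])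
  finally show ?thesis .
qed

lemma X_in_image:
  assumes "u \<noteq> 0" shows "X u \<in> X ` sphere 0 1"
  using X_scale[of "1 / norm u" u] assms
  by (intro image_eqI[of _ _ "(1 / norm u) *\<^sub>R u"]) auto

lemma compact_closure_X: "compact (closure (X ` sphere 0 1))"
proof -
  have "norm (X u) \<le> tail 0" for u using norm_X_minus_X_part[of u 0] by (simp add: X_part_def)
  then have "bounded (X ` sphere 0 1)" by (auto simp: bounded_iff)
  then show ?thesis by (simp add: compact_closure)
qed

text \<open>
  A point of \<open>Z n\<close> outside the hull could be separated from it strictly by some direction \<open>u \<noteq> 0\<close>,
  but \<open>X u\<close> lies in the hull and is at least as far in that direction.
\<close>

lemma Z_subset_hull: "Z n \<subseteq> convex hull (closure (X ` sphere 0 1))"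
proof (rule ccontr)
  let ?L = "convex hull (closure (X ` sphere 0 1))"
  assume "\<not> Z n \<subseteq> ?L"
  then obtain z where z: "z \<in> Z n" "z \<notin> ?L" by blast
  have "closed ?L" by (intro compact_imp_closed compact_convex_hull compact_closure_X)
  from separating_hyperplane_closed_point[OF convex_convex_hull this z(2)]
  obtain a b where ab: "a \<bullet> z < b" "\<And>x. x \<in> ?L \<Longrightarrow> a \<bullet> x > b" by blast
  have inL: "X u \<in> ?L" if "u \<noteq> 0" for u
    using X_in_image[OF that] by (intro hull_inc subsetD[OF closure_subset])
  obtain b0 :: 'a where "b0 \<in> Basis" using nonempty_Basis by blast
  then have "X b0 \<in> ?L" by (intro inL) auto
  with ab have "a \<noteq> 0" by force
  then have "a \<bullet> X (- a) > b" by (intro ab inL) simp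
  moreover have "(- a) \<bullet> z \<le> (- a) \<bullet> X (- a)" by (rule inner_le_inner_X[OF z(1)])
  ultimately show False using ab(1) by simp
qed

text \<open>
  The right-hand side is compact and convex, so it suffices that it contains each \<open>X u\<close>, which is
  within \<open>tail n\<close> of the partial sum \<open>X_part n u\<close>.
\<close>

lemma hull_subset_Z_plus:
  "convex hull (closure (X ` sphere 0 1)) \<subseteq> Z n + cball 0 (tail n)"
proof (intro hull_minimal closure_minimal)
  show "X ` sphere 0 1 \<subseteq> Z n + cball 0 (tail n)"
  proof
    fix x assume "x \<in> X ` sphere 0 1"
    then obtain u where "x = X u" by auto
    then have "x = X_part n u + (X u - X_part n u)" "X u - X_part n u \<in> cball 0 (tail n)"
      using norm_X_minus_X_part[of u n] by auto
    then show "x \<in> Z n + cball 0 (tail n)" using X_part_in_Z set_plus_intro by metis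
  qed
  show "closed (Z n + cball 0 (tail n))"
    by (intro compact_imp_closed compact_set_plus compact_Z compact_cball)
  show "convex (Z n + cball 0 (tail n))" by (intro convex_set_plus convex_Z convex_cball)
qed

lemma hausdorff_lim_Z: "hausdorff_lim Z = convex hull (closure (X ` sphere 0 1))"
proof (rule hausdorff_lim_eqI)
  let ?L = "convex hull (closure (X ` sphere 0 1))"
  show "compact (Z n)" for n by (rule compact_Z)
  show ne: "Z n \<noteq> {}" for n using X_part_in_Z by blast
  show "compact ?L" by (intro compact_convex_hull compact_closure_X)
  show neL: "?L \<noteq> {}" using ne Z_subset_hull by blast
  have "0 \<le> hausdorff_dist (Z n) ?L" "hausdorff_dist (Z n) ?L \<le> tail n" for n
  proof -
    have "(SUP x\<in>Z n. infdist x ?L) = (SUP x\<in>Z n. 0)"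
      using Z_subset_hull by (intro SUP_cong) (auto intro: infdist_zero)
    then have eq: "(SUP x\<in>Z n. infdist x ?L) = 0" using ne by simp
    then show "0 \<le> hausdorff_dist (Z n) ?L" by (simp add: hausdorff_dist_def)
    have "infdist x (Z n) \<le> tail n" if x: "x \<in> ?L" for x
    proof -
      obtain z y where "z \<in> Z n" "y \<in> cball 0 (tail n)" "x = z + y"
        using subsetD[OF hull_subset_Z_plus x] by (rule set_plus_elim)
      then show ?thesis by (intro infdist_le2[of z]) (auto simp: dist_norm)
    qed
    then have "(SUP x\<in>?L. infdist x (Z n)) \<le> tail n" using neL by (intro cSUP_least)
    with eq tail_nonneg show "hausdorff_dist (Z n) ?L \<le> tail n" by (simp add: hausdorff_dist_def)
  qed
  then show "(\<lambda>n. hausdorff_dist (Z n) ?L) \<longlonglongrightarrow> 0"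
    by (intro tendsto_sandwich[OF _ _ tendsto_const tail_tendsto_0]) auto
qed

lemma extreme_points_hausdorff_lim_Z: "{x. x extreme_point_of hausdorff_lim Z} \<subseteq> closure (X ` sphere 0 1)"
  unfolding hausdorff_lim_Z by (rule extreme_points_of_convex_hull)

end

section \<open>Growth of the arrival times\<close>

context prob_space begin

lemma nn_integral_exp_minus_exponential:
  assumes "distributed M lborel X (exponential_density 1)"
  shows "(\<integral>\<^sup>+\<omega>. ennreal (exp (- X \<omega>)) \<partial>M) = ennreal (1 / 2)"
proof -
  interpret E: prob_space "density lborel (exponential_density 2)"
    by (rule prob_space_exponential_density) simp
  have one: "(\<integral>\<^sup>+x. ennreal (exponential_density 2 x) \<partial>lborel) = 1"
    using E.emeasure_space_1 by (simp add: emeasure_density)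
  have "(\<integral>\<^sup>+\<omega>. ennreal (exp (- X \<omega>)) \<partial>M)
      = (\<integral>\<^sup>+x. ennreal (exponential_density 1 x) * ennreal (exp (- x)) \<partial>lborel)"
    by (rule distributed_nn_integral[OF assms, symmetric]) simp
  also have "\<dots> = (\<integral>\<^sup>+x. ennreal (1 / 2) * ennreal (exponential_density 2 x) \<partial>lborel)"
  proof (rule nn_integral_cong)
    fix x :: real
    have "exp (- x) * exp (- x) = exp (- (x * 2))" by (simp flip: exp_add)
    then have eq: "exponential_density 1 x * exp (- x) = 1 / 2 * exponential_density 2 x"
      unfolding exponential_density_def by simp
    have "ennreal (exponential_density 1 x) * ennreal (exp (- x)) = ennreal (exponential_density 1 x * exp (- x))"
      by (rule ennreal_mult''[symmetric]) simp
    also have "\<dots> = ennreal (1 / 2) * ennreal (exponential_density 2 x)"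
      unfolding eq by (rule ennreal_mult') simp
    finally show "ennreal (exponential_density 1 x) * ennreal (exp (- x))
        = ennreal (1 / 2) * ennreal (exponential_density 2 x)" .
  qed
  also have "\<dots> = ennreal (1 / 2)" by (simp add: nn_integral_cmult one)
  finally show ?thesis .
qed

text \<open>
  A Chernoff bound. Since the exponential moment of \<open>- \<tau> k\<close> is \<open>1 / 2\<close>, that of
  \<open>(k + 1) / 2 - \<Gamma> \<tau> k\<close> is \<open>q ^ (k + 1)\<close> with \<open>q = exp (1 / 2) / 2 < 1\<close>. Summed over \<open>k\<close> these are
  finite, so almost surely the exponentials tend to zero.
\<close>

lemma AE_eventually_Gamma_ge:
  assumes exp: "\<And>k. distributed M lborel (\<tau> k) (exponential_density 1)"
    and ind: "indep_vars (\<lambda>_. borel) \<tau> UNIV"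
  shows "AE \<omega> in M. \<forall>\<^sub>F k in sequentially. (real k + 1) / 2 \<le> \<Gamma> \<tau> k \<omega>"
proof -
  have [measurable]: "\<tau> k \<in> borel_measurable M" for k
    using ind by (auto simp: indep_vars_def)
  define q :: real where "q = exp (1 / 2) / 2"
  have q: "0 < q" "q < 1" using exp_bound[of "1 / 2"] by (auto simp: q_def power2_eq_square)
  have E: "(\<integral>\<^sup>+\<omega>. ennreal (exp ((real k + 1) / 2 - \<Gamma> \<tau> k \<omega>)) \<partial>M) = ennreal (q ^ Suc k)" for k
  proof -
    have "(\<integral>\<^sup>+\<omega>. ennreal (exp ((real k + 1) / 2 - \<Gamma> \<tau> k \<omega>)) \<partial>M)
        = (\<integral>\<^sup>+\<omega>. ennreal (exp ((real k + 1) / 2)) * (\<Prod>j\<le>k. ennreal (exp (- \<tau> j \<omega>))) \<partial>M)"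
    proof (rule nn_integral_cong)
      fix \<omega>
      have "exp ((real k + 1) / 2 - \<Gamma> \<tau> k \<omega>) = exp ((real k + 1) / 2) * exp (\<Sum>j\<le>k. - \<tau> j \<omega>)"
        unfolding \<Gamma>_def sum_negf by (simp only: exp_add[symmetric] diff_conv_add_uminus)
      also have "exp (\<Sum>j\<le>k. - \<tau> j \<omega>) = (\<Prod>j\<le>k. exp (- \<tau> j \<omega>))" by (rule exp_sum) simp
      finally have eq: "exp ((real k + 1) / 2 - \<Gamma> \<tau> k \<omega>) = exp ((real k + 1) / 2) * (\<Prod>j\<le>k. exp (- \<tau> j \<omega>))" .
      have "(\<Prod>j\<le>k. ennreal (exp (- \<tau> j \<omega>))) = ennreal (\<Prod>j\<le>k. exp (- \<tau> j \<omega>))"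
        by (rule prod_ennreal) simp
      then show "ennreal (exp ((real k + 1) / 2 - \<Gamma> \<tau> k \<omega>))
          = ennreal (exp ((real k + 1) / 2)) * (\<Prod>j\<le>k. ennreal (exp (- \<tau> j \<omega>)))"
        unfolding eq by (simp only: ennreal_mult'[OF exp_ge_zero])
    qed
    also have "\<dots> = ennreal (exp ((real k + 1) / 2)) * (\<integral>\<^sup>+\<omega>. (\<Prod>j\<le>k. ennreal (exp (- \<tau> j \<omega>))) \<partial>M)"
      by (intro nn_integral_cmult) measurable
    also have "(\<integral>\<^sup>+\<omega>. (\<Prod>j\<le>k. ennreal (exp (- \<tau> j \<omega>))) \<partial>M) = (\<Prod>j\<le>k. \<integral>\<^sup>+\<omega>. ennreal (exp (- \<tau> j \<omega>)) \<partial>M)"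
      by (intro indep_vars_nn_integral indep_vars_compose2[OF indep_vars_subset[OF ind]]) auto
    also have "\<dots> = ennreal ((1 / 2) ^ Suc k)"
      unfolding nn_integral_exp_minus_exponential[OF exp] by (subst prod_ennreal) simp_all
    also have "ennreal (exp ((real k + 1) / 2)) * \<dots> = ennreal (exp (real (Suc k) * (1 / 2)) * (1 / 2) ^ Suc k)"
      by (subst ennreal_mult'[OF exp_ge_zero]) (simp add: add.commute)
    also have "exp (real (Suc k) * (1 / 2)) * (1 / 2) ^ Suc k = q ^ Suc k"
      unfolding exp_of_nat_mult q_def by (simp add: power_divide)
    finally show ?thesis .
  qed
  have [measurable]: "(\<lambda>\<omega>. \<Gamma> \<tau> k \<omega>) \<in> borel_measurable M" for k
    unfolding \<Gamma>_def by measurable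
  have "(\<integral>\<^sup>+\<omega>. (\<Sum>k. ennreal (exp ((real k + 1) / 2 - \<Gamma> \<tau> k \<omega>))) \<partial>M) = (\<Sum>k. ennreal (q ^ Suc k))"
    by (subst nn_integral_suminf) (auto simp: E)
  also have "\<dots> < \<infinity>"
  proof -
    have "summable (\<lambda>k. q ^ Suc k)" using q by (subst summable_Suc_iff) (simp add: summable_geometric)
    then show ?thesis using q by (subst suminf_ennreal2) auto
  qed
  finally have "AE \<omega> in M. (\<Sum>k. ennreal (exp ((real k + 1) / 2 - \<Gamma> \<tau> k \<omega>))) \<noteq> \<infinity>"
    by (intro nn_integral_PInf_AE) (auto simp: less_top)
  then show ?thesis
  proof eventually_elim
    case (elim \<omega>)
    then have "summable (\<lambda>k. exp ((real k + 1) / 2 - \<Gamma> \<tau> k \<omega>))"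
      by (intro summable_suminf_not_top) auto
    then have "\<forall>\<^sub>F k in sequentially. exp ((real k + 1) / 2 - \<Gamma> \<tau> k \<omega>) < 1"
      by (intro order_tendstoD(2)[OF summable_LIMSEQ_zero]) auto
    then show ?case by eventually_elim simp
  qed
qed

lemma AE_norm_uniform_sphere:
  assumes "X \<in> borel_measurable M" "uniform_sphere_law (distr M borel X)"
  shows "AE \<omega> in M. norm (X \<omega>) = 1"
proof -
  have "emeasure (distr M borel X) (sphere 0 1) = 1"
    using assms(2) unfolding uniform_sphere_law_def by blast
  then have "prob (X -` sphere 0 1 \<inter> space M) = 1"
    using assms(1) by (simp add: emeasure_distr measure_def)
  from AE_prob_1[OF this] show ?thesis by eventually_elim auto
qed

end

text \<open>
  The constant depends on the realisation. It takes care of the finitely many \<open>k\<close> for which the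
  lower bound on \<open>\<Gamma>\<close> may fail.
\<close>

lemma gamma_power_decay:
  assumes \<alpha>: "\<alpha> > 0" and ev: "\<forall>\<^sub>F k in sequentially. (real k + 1) / 2 \<le> \<Gamma> \<tau> k \<omega>"
  obtains C where "\<And>k. \<gamma> \<alpha> \<tau> k \<omega> \<le> C * (real k + 1) powr (- (1 / \<alpha>))"
proof -
  define a where "a = 1 / \<alpha>"
  have a: "a > 0" using \<alpha> by (simp add: a_def)
  have \<gamma>: "\<gamma> \<alpha> \<tau> k \<omega> = \<Gamma> \<tau> k \<omega> powr (- a)" for k by (simp add: \<gamma>_def a_def)
  obtain K where K: "\<And>k. k \<ge> K \<Longrightarrow> (real k + 1) / 2 \<le> \<Gamma> \<tau> k \<omega>"
    using ev by (auto simp: eventually_sequentially)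
  define C where "C = 2 powr a + (\<Sum>j<K. \<gamma> \<alpha> \<tau> j \<omega> * (real j + 1) powr a)"
  have nonneg: "\<gamma> \<alpha> \<tau> j \<omega> * (real j + 1) powr a \<ge> 0" for j by (simp add: \<gamma>)
  have "\<gamma> \<alpha> \<tau> k \<omega> * (real k + 1) powr a \<le> C" for k
  proof (cases "k < K")
    case True
    then have "\<gamma> \<alpha> \<tau> k \<omega> * (real k + 1) powr a \<le> (\<Sum>j<K. \<gamma> \<alpha> \<tau> j \<omega> * (real j + 1) powr a)"
      using nonneg by (intro member_le_sum) auto
    then show ?thesis unfolding C_def by (smt (verit) powr_ge_zero)
  next
    case False
    then have "\<Gamma> \<tau> k \<omega> powr (- a) \<le> ((real k + 1) / 2) powr (- a)"
      using a by (intro powr_mono2' K) auto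
    then have "\<gamma> \<alpha> \<tau> k \<omega> * (real k + 1) powr a \<le> ((real k + 1) / 2) powr (- a) * (real k + 1) powr a"
      unfolding \<gamma> by (intro mult_right_mono) auto
    also have "\<dots> = 2 powr a" by (simp add: powr_divide powr_minus_divide)
    also have "\<dots> \<le> C" unfolding C_def using nonneg by (simp add: sum_nonneg)
    finally show ?thesis .
  qed
  then have "\<gamma> \<alpha> \<tau> k \<omega> \<le> C * (real k + 1) powr (- a)" for k
    using pos_le_divide_eq[of "(real k + 1) powr a" "\<gamma> \<alpha> \<tau> k \<omega>" C] by (simp add: powr_minus_divide)
  then show thesis using that unfolding a_def by blast
qed

section \<open>The dimension bounds\<close>

theorem theorem5p5:
  fixes M :: "'w measure"
    and \<alpha> :: real
    and N :: nat
    and \<tau> :: "nat \<Rightarrow> 'w \<Rightarrow> real"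
    and \<epsilon> :: "nat \<Rightarrow> 'w \<Rightarrow> 'a::euclidean_space"
  assumes dim: "DIM('a) \<ge> 2" and N: "N = DIM('a) - 1"
    and alpha: "0 < \<alpha>" "\<alpha> < 1"
    and M: "prob_space M"
    and tau_exp: "\<And>k. distributed M lborel (\<tau> k) (exponential_density 1)"
    and tau_indep: "prob_space.indep_vars M (\<lambda>_. borel) \<tau> UNIV"
    and eps_unif: "\<And>k. uniform_sphere_law (distr M borel (\<epsilon> k))"
    and eps_indep: "prob_space.indep_vars M (\<lambda>_. borel) \<epsilon> UNIV"
    and tau_eps_indep: "prob_space.indep_set M
          (sets (vimage_algebra (space M) (\<lambda>\<omega> k. \<tau> k \<omega>) (Pi\<^sub>M UNIV (\<lambda>_. borel))))
          (sets (vimage_algebra (space M) (\<lambda>\<omega> k. \<epsilon> k \<omega>) (Pi\<^sub>M UNIV (\<lambda>_. borel))))"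
  shows "(AE \<omega> in M. hausdorff_dim (closure (X_field \<alpha> \<tau> \<epsilon> \<omega> ` sphere 0 1)) \<le> ennreal (real N * \<alpha>)) \<and>
         (AE \<omega> in M. hausdorff_dim (F_ext \<alpha> \<tau> \<epsilon> \<omega>) \<le> ennreal (real N * \<alpha>))"
proof -
  interpret prob_space M by (rule M)
  define a where "a = 1 / \<alpha>"
  have a: "a > 1" using alpha by (simp add: a_def)
  \<comment> \<open>Exponents decreasing to \<open>N \<alpha>\<close>; a sequence, so that one null set serves all of them.\<close>
  define s where "s j = real N * \<alpha> + 1 / real (Suc j)" for j :: nat
  have s: "s j > 0" "s j * a > real (DIM('a) - 1)" for j
  proof -
    show "s j > 0" using alpha by (auto simp: s_def intro!: add_nonneg_pos)
    have "s j * a = real N + a / real (Suc j)" using alpha by (simp add: s_def a_def add_divide_distrib)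
    moreover have "a / real (Suc j) > 0" using a by simp
    ultimately show "s j * a > real (DIM('a) - 1)" unfolding N by linarith
  qed
  have "AE \<omega> in M. \<forall>k. norm (\<epsilon> k \<omega>) = 1"
    unfolding AE_all_countable using eps_indep eps_unif
    by (auto intro!: AE_norm_uniform_sphere simp: indep_vars_def)
  moreover have "AE \<omega> in M. \<forall>\<^sub>F k in sequentially. (real k + 1) / 2 \<le> \<Gamma> \<tau> k \<omega>"
    by (rule AE_eventually_Gamma_ge[OF tau_exp tau_indep])
  moreover have "AE \<omega> in M. \<forall>j. \<forall>\<eta>>0. \<exists>n\<ge>1. shell_cost (s j) a n (\<lambda>k. \<epsilon> k \<omega>) < \<eta>"
    unfolding AE_all_countable by (intro allI AE_shell_cost_arbitrarily_small eps_indep eps_unif a s)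
  ultimately have "AE \<omega> in M. hausdorff_dim (closure (X_field \<alpha> \<tau> \<epsilon> \<omega> ` sphere 0 1)) \<le> ennreal (real N * \<alpha>) \<and>
     F_ext \<alpha> \<tau> \<epsilon> \<omega> \<subseteq> closure (X_field \<alpha> \<tau> \<epsilon> \<omega> ` sphere 0 1)"
  proof eventually_elim
    case (elim \<omega>)
    obtain C where C: "\<And>k. \<gamma> \<alpha> \<tau> k \<omega> \<le> C * (real k + 1) powr (- a)"
      using gamma_power_decay[OF alpha(1) elim(2)] unfolding a_def by blast
    have pos: "0 \<le> \<gamma> \<alpha> \<tau> k \<omega>" for k by (simp add: \<gamma>_def)
    have "summable (\<lambda>k. real (Suc k) powr (- a))"
      using a by (subst summable_Suc_iff) (simp add: summable_real_powr_iff)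
    then have "summable (\<lambda>k. C * (real k + 1) powr (- a))"
      by (intro summable_mult) (simp add: add.commute)
    then have sum: "summable (\<lambda>k. \<gamma> \<alpha> \<tau> k \<omega>)"
      by (rule summable_comparison_test'[of _ 0]) (use pos C in auto)
    interpret J: jump_series "\<lambda>k. \<gamma> \<alpha> \<tau> k \<omega>" "\<lambda>k. \<epsilon> k \<omega>"
      by standard (use pos sum elim(1) in auto)
    have X: "X_field \<alpha> \<tau> \<epsilon> \<omega> = J.X" by (simp add: fun_eq_iff X_field_def J.X_def)
    have Z: "Z_partial \<alpha> \<tau> \<epsilon> \<omega> = J.Z" by (simp add: fun_eq_iff Z_partial_def J.Z_def)
    have "hausdorff_measure (s j) (closure (J.X ` sphere 0 1)) = 0" for j
      using elim(3) by (intro J.hausdorff_measure_closure_X_eq_0[OF a s(1) C]) blast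
    then have "hausdorff_dim (closure (J.X ` sphere 0 1)) \<le> ennreal (s j)" for j
      by (rule hausdorff_dim_leI[OF less_imp_le[OF s(1)]])
    moreover have "s \<longlonglongrightarrow> real N * \<alpha> + 0"
      unfolding s_def by (intro tendsto_add tendsto_const LIMSEQ_Suc[OF lim_1_over_n])
    then have "(\<lambda>j. ennreal (s j)) \<longlonglongrightarrow> ennreal (real N * \<alpha>)" by (intro tendsto_ennrealI) simp
    ultimately have "hausdorff_dim (closure (J.X ` sphere 0 1)) \<le> ennreal (real N * \<alpha>)"
      by (intro LIMSEQ_le_const) auto
    then show ?case
      using J.extreme_points_hausdorff_lim_Z by (simp add: X F_ext_def Z_zonoid_def Z)
  qed
  then show ?thesis
    unfolding AE_conj_iff[symmetric]
    by eventually_elim (metis hausdorff_dim_mono order_trans)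
qed

end
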